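(* Let $k \geq 1$ be an integer, let $\mathsf{q} \in \mathbb{C}$ be nonzero and not a root of unity, and let $\mathsf{V}_{\mathsf{q}} = \mathbb{C}x \oplus \mathbb{C}y$ be the natural two-dimensional module of the quantum enveloping algebra $\mathsf{U}_{\mathsf{q}} = \mathsf{U}_{\mathsf{q}}(\mathfrak{gl}(1|1))$. Let the planar rook algebra $\mathbb{C}\mathsf{P}_{k-1}$ act on $\mathsf{V}_{\mathsf{q}}^{\otimes k}$ by the linear extension of $$d\, v_{\mathsf{s}} = v_{d\mathsf{s}}, \qquad d\,(F v_{\mathsf{s}}) = F v_{d\mathsf{s}} \qquad (d \in \mathsf{P}_{k-1},\ \mathsf{s} \subseteq \{1,\dots,k-1\}),$$ where $v_{d\mathsf{s}}$ is interpreted as $0$ if $\mathsf{s} \not\subseteq \beta(d)$. Then $$\mathsf{End}_{\mathsf{U}_{\mathsf{q}}}(\mathsf{V}_{\mathsf{q}}^{\otimes k}) = \mathbb{C}\mathsf{P}_{k-1},$$ that is, the algebra homomorphism $\mathbb{C}\mathsf{P}_{k-1} \to \mathsf{End}_{\mathbb{C}}(\mathsf{V}_{\mathsf{q}}^{\otimes k})$ given by this action is injective and its image is exactly $\mathsf{End}_{\mathsf{U}_{\mathsf{q}}}(\mathsf{V}_{\mathsf{q}}^{\otimes k})$, the algebra of linear endomorphisms of $\mathsf{V}_{\mathsf{q}}^{\otimes k}$ commuting with the action of $\mathsf{U}_{\mathsf{q}}$.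
   Context: Let $\mathsf{P} = \mathbb{Z}\varepsilon_1 \oplus \mathbb{Z}\varepsilon_2$ and let $\mathsf{P}^* = \mathbb{Z}h_1 \oplus \mathbb{Z}h_2$ be its dual, with pairing $\langle h_i, \varepsilon_j\rangle = \delta_{i,j}$; set $\alpha = \varepsilon_1 - \varepsilon_2$. (This lattice $\mathsf{P}$ is unrelated to the monoids $\mathsf{P}_n$ below.) For nonzero $\mathsf{q} \in \mathbb{C}$ (with $\mathsf{q} \neq \mathsf{q}^{-1}$), $\mathsf{U}_{\mathsf{q}} = \mathsf{U}_{\mathsf{q}}(\mathfrak{gl}(1|1))$ is the unital Hopf algebra over $\mathbb{C}$ with generators $E, F, \sigma, q^h$ ($h \in \mathsf{P}^*$) and relations, for all $h,h' \in \mathsf{P}^*$: $q^0 = 1$, $q^hq^{h'} = q^{h+h'}$, $q^hE = \mathsf{q}^{\langle h,\alpha\rangle}Eq^h$, $q^hF = \mathsf{q}^{-\langle h,\alpha\rangle}Fq^h$, $EF + FE = \dfrac{K - K^{-1}}{\mathsf{q} - \mathsf{q}^{-1}}$ where $K = q^{h_1+h_2}$, $E^2 = 0 = F^2$, $\sigma E = -E\sigma$, $\sigma F = -F\sigma$, $\sigma q^h = q^h\sigma$, $\sigma^2 = 1$. The coproduct is $\Delta(E) = E \otimes K^{-1} + \sigma \otimes E$, $\Delta(F) = F \otimes 1 + \sigma K \otimes F$, $\Delta(q^h) = q^h \otimes q^h$, $\Delta(\sigma) = \sigma \otimes \sigma$; it defines the action of $\mathsf{U}_{\mathsf{q}}$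 on tensor products of modules. The natural module $\mathsf{V}_{\mathsf{q}} = \mathbb{C}x \oplus \mathbb{C}y$ has action $Ex = 0$, $Ey = x$, $Fx = y$, $Fy = 0$, $q^hx = \mathsf{q}^{\langle h,\varepsilon_1\rangle}x$, $q^hy = \mathsf{q}^{\langle h,\varepsilon_2\rangle}y$, $\sigma x = x$, $\sigma y = -y$. For $\mathsf{s} \subseteq \{1,\dots,k-1\}$ set $u_{\mathsf{s}} = u_1 \otimes \cdots \otimes u_{k-1}$ with $u_i = x$ if $i \in \mathsf{s}$ and $u_i = y$ if $i \notin \mathsf{s}$, and $v_{\mathsf{s}} = E(y \otimes u_{\mathsf{s}}) = \mathsf{q}^{1-k}\,x \otimes u_{\mathsf{s}} - y \otimes Eu_{\mathsf{s}} \in \mathsf{V}_{\mathsf{q}}^{\otimes k}$ (for $k=1$, $v_\emptyset = Ey = x$). When $\mathsf{q}$ is not a root of unity, the vectors $v_{\mathsf{s}}, Fv_{\mathsf{s}}$, with $\mathsf{s}$ ranging over all subsets of $\{1,\dots,k-1\}$, form a basis of $\mathsf{V}_{\mathsf{q}}^{\otimes k}$. The planar rook monoid $\mathsf{P}_n$ consists of the diagrams with two rows of $n$ vertices (each row labeled $1,\dots,n$ from left to right) in which each vertex is incident to at most one edge, each edge joins a bottom vertex to a top vertex, and no two edges cross. Equivalently, $\mathsf{P}_n$ is the monoid of all order-preserving partial permutations of $\{1,\dots,n\}$: a diagram $d$ is an order-preserving bijection $d: \beta(d) \to \tau(d)$, where $\beta(d)$ (resp. $\tau(d)$) is the set of bottom-row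 (resp. top-row) vertices with an edge. The product $d_1d_2$ is concatenation of diagrams with $d_1$ placed above $d_2$ (keeping the edges that connect through), i.e. composition of partial maps with $d_2$ applied first. The planar rook algebra $\mathbb{C}\mathsf{P}_n$ is the monoid algebra of $\mathsf{P}_n$ over $\mathbb{C}$: it has basis $\mathsf{P}_n$ and multiplication extended linearly; $\mathbb{C}\mathsf{P}_0 = \mathbb{C}$. For $\mathsf{s} \subseteq \beta(d)$, $d\mathsf{s}$ denotes the image of $\mathsf{s}$ under $d$. *)

theory Defs
  imports
    Complex_Main
    "HOL-Library.FuncSet"
    "HOL-Library.Product_Plus"
    "HOL-Library.Poly_Mapping"
    "HOL-Algebra.Ring"
begin

section \<open>Free algebras and linear extension\<close>

text \<open>
  Words form a monoid under concatenation, written additively because this is how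
  \<open>Poly_Mapping\<close> turns a monoid into its monoid algebra.  Hence \<open>'a word \<Rightarrow>\<^sub>0 complex\<close>, with
  the library's \<open>+\<close>, \<open>*\<close>, \<open>0\<close>, \<open>1\<close>, is the free unital associative complex algebra on the
  set \<open>'a\<close>; equivalently it is the tensor algebra of the vector space with basis \<open>'a\<close>,
  and then \<open>*\<close> is the tensor product of tensors.
\<close>

datatype 'a word = Word (letters: "'a list")

instantiation word :: (type) monoid_add
begin

definition zero_word :: "'a word" where "0 = Word []"

definition plus_word :: "'a word \<Rightarrow> 'a word \<Rightarrow> 'a word" where
  "v + w = Word (letters v @ letters w)"

instance by standard (simp_all add: zero_word_def plus_word_def)

end

definition scale :: "complex \<Rightarrow> ('b \<Rightarrow>\<^sub>0 complex) \<Rightarrow> ('b \<Rightarrow>\<^sub>0 complex)" where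
  "scale c f = Poly_Mapping.map ((*) c) f"

definition lin_ext :: "('b \<Rightarrow> ('c \<Rightarrow>\<^sub>0 complex)) \<Rightarrow> ('b \<Rightarrow>\<^sub>0 complex) \<Rightarrow> ('c \<Rightarrow>\<^sub>0 complex)" where
  "lin_ext g f = (\<Sum>b\<in>Poly_Mapping.keys f. scale (Poly_Mapping.lookup f b) (g b))"

definition mon :: "'a list \<Rightarrow> 'a word \<Rightarrow>\<^sub>0 complex" where
  "mon w = Poly_Mapping.single (Word w) 1"


section \<open>The quantum enveloping algebra of gl(1|1)\<close>

text \<open>Both lattices are \<open>int \<times> int\<close>: weights in the basis \<open>\<epsilon>\<^sub>1, \<epsilon>\<^sub>2\<close>, coweights in the dual basis
  \<open>h\<^sub>1, h\<^sub>2\<close>.\<close>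

definition pairing :: "int \<times> int \<Rightarrow> int \<times> int \<Rightarrow> int" where
  "pairing h p = fst h * fst p + snd h * snd p"

definition eps1 :: "int \<times> int" where "eps1 = (1, 0)"
definition eps2 :: "int \<times> int" where "eps2 = (0, 1)"
definition alpha :: "int \<times> int" where "alpha = eps1 - eps2"
definition h1 :: "int \<times> int" where "h1 = (1, 0)"
definition h2 :: "int \<times> int" where "h2 = (0, 1)"

datatype gen = gE | gF | gSigma | gQ "int \<times> int"

definition gK :: gen where "gK = gQ (h1 + h2)"
definition gKinv :: gen where "gKinv = gQ (- (h1 + h2))"

type_synonym free_alg = "gen word \<Rightarrow>\<^sub>0 complex"

definition gen :: "gen \<Rightarrow> free_alg" where "gen g = mon [g]"

inductive uq_rel :: "complex \<Rightarrow> free_alg \<Rightarrow> free_alg \<Rightarrow> bool" for q :: complex where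
  "uq_rel q (gen (gQ 0)) 1"
| "uq_rel q (gen (gQ h) * gen (gQ h')) (gen (gQ (h + h')))"
| "uq_rel q (gen (gQ h) * gen gE) (scale (q powi pairing h alpha) (gen gE * gen (gQ h)))"
| "uq_rel q (gen (gQ h) * gen gF) (scale (q powi (- pairing h alpha)) (gen gF * gen (gQ h)))"
| "uq_rel q (gen gE * gen gF + gen gF * gen gE) (scale (1 / (q - inverse q)) (gen gK - gen gKinv))"
| "uq_rel q (gen gE * gen gE) 0"
| "uq_rel q (gen gF * gen gF) 0"
| "uq_rel q (gen gSigma * gen gE) (- (gen gE * gen gSigma))"
| "uq_rel q (gen gSigma * gen gF) (- (gen gF * gen gSigma))"
| "uq_rel q (gen gSigma * gen (gQ h)) (gen (gQ h) * gen gSigma)"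
| "uq_rel q (gen gSigma * gen gSigma) 1"

text \<open>The two-sided ideal generated by the relations.\<close>

inductive_set uq_ideal :: "complex \<Rightarrow> free_alg set" for q :: complex where
  rel: "uq_rel q a b \<Longrightarrow> a - b \<in> uq_ideal q"
| zero: "0 \<in> uq_ideal q"
| add: "a \<in> uq_ideal q \<Longrightarrow> b \<in> uq_ideal q \<Longrightarrow> a + b \<in> uq_ideal q"
| left: "a \<in> uq_ideal q \<Longrightarrow> x * a \<in> uq_ideal q"
| right: "a \<in> uq_ideal q \<Longrightarrow> a * x \<in> uq_ideal q"

definition uq_cong :: "complex \<Rightarrow> free_alg rel" where
  "uq_cong q = {(a, b). a - b \<in> uq_ideal q}"

definition Uq :: "complex \<Rightarrow> free_alg set set" where
  "Uq q = UNIV // uq_cong q"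

text \<open>The coproduct on generators, a list of pure tensors of monomials standing for their sum
  (all coefficients are 1).\<close>

fun coproduct :: "gen \<Rightarrow> (gen list \<times> gen list) list" where
  "coproduct gE = [([gE], [gKinv]), ([gSigma], [gE])]"
| "coproduct gF = [([gF], []), ([gSigma, gK], [gF])]"
| "coproduct gSigma = [([gSigma], [gSigma])]"
| "coproduct (gQ h) = [([gQ h], [gQ h])]"


section \<open>The natural module and its tensor powers\<close>

datatype basis = Bx | By

type_synonym tensor = "basis word \<Rightarrow>\<^sub>0 complex"

definition tpow :: "nat \<Rightarrow> tensor set" where
  "tpow k = {f. \<forall>w\<in>Poly_Mapping.keys f. length (letters w) = k}"

fun natural_act :: "complex \<Rightarrow> gen \<Rightarrow> basis \<Rightarrow> tensor" where
  "natural_act q gE Bx = 0"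
| "natural_act q gE By = mon [Bx]"
| "natural_act q gF Bx = mon [By]"
| "natural_act q gF By = 0"
| "natural_act q (gQ h) Bx = scale (q powi pairing h eps1) (mon [Bx])"
| "natural_act q (gQ h) By = scale (q powi pairing h eps2) (mon [By])"
| "natural_act q gSigma Bx = mon [Bx]"
| "natural_act q gSigma By = - mon [By]"

text \<open>The operator \<open>A \<otimes> B\<close> on \<open>V \<otimes> V\<^sup>\<otimes>\<^sup>n\<close>, with \<open>A\<close> acting on the first factor.\<close>

definition op_tensor :: "(tensor \<Rightarrow> tensor) \<Rightarrow> (tensor \<Rightarrow> tensor) \<Rightarrow> tensor \<Rightarrow> tensor" where
  "op_tensor A B = lin_ext (\<lambda>w. case letters w of [] \<Rightarrow> 0 | l # v \<Rightarrow> A (mon [l]) * B (mon v))"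

text \<open>The action of a generator on the \<open>k\<close>-th tensor power, for \<open>k \<ge> 2\<close> through the coproduct on
  \<open>V \<otimes> V\<^sup>\<otimes>\<^sup>(\<^sup>k\<^sup>-\<^sup>1\<^sup>)\<close>.  The zeroth power is the trivial module given by the counit.\<close>

fun gact :: "complex \<Rightarrow> nat \<Rightarrow> gen \<Rightarrow> tensor \<Rightarrow> tensor" where
  "gact q 0 g f = (if g = gE \<or> g = gF then 0 else f)"
| "gact q (Suc 0) g f = lin_ext (\<lambda>w. case letters w of [l] \<Rightarrow> natural_act q g l | _ \<Rightarrow> 0) f"
| "gact q (Suc (Suc n)) g f =
     (\<Sum>(a, b)\<leftarrow>coproduct g. op_tensor (foldr (gact q (Suc 0)) a) (foldr (gact q (Suc n)) b) f)"

definition free_act :: "complex \<Rightarrow> nat \<Rightarrow> free_alg \<Rightarrow> tensor \<Rightarrow> tensor" where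
  "free_act q k t f = lin_ext (\<lambda>w. foldr (gact q k) (letters w) f) t"

text \<open>The choice of representative is immaterial on \<open>tpow k\<close>, see \<open>uq_act_class\<close> below.\<close>

definition uq_act :: "complex \<Rightarrow> nat \<Rightarrow> free_alg set \<Rightarrow> tensor \<Rightarrow> tensor" where
  "uq_act q k u f = free_act q k (SOME t. t \<in> u) f"


section \<open>Endomorphism algebras\<close>

definition EndC :: "nat \<Rightarrow> (tensor \<Rightarrow> tensor) ring" where
  "EndC k = \<lparr>
     carrier = {\<phi> \<in> tpow k \<rightarrow>\<^sub>E tpow k.
        (\<forall>f\<in>tpow k. \<forall>g\<in>tpow k. \<phi> (f + g) = \<phi> f + \<phi> g) \<and>
        (\<forall>c. \<forall>f\<in>tpow k. \<phi> (scale c f) = scale c (\<phi> f))},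
     mult = compose (tpow k),
     one = (\<lambda>f\<in>tpow k. f),
     zero = (\<lambda>f\<in>tpow k. 0),
     add = (\<lambda>\<phi> \<psi>. \<lambda>f\<in>tpow k. \<phi> f + \<psi> f)\<rparr>"

definition End_Uq :: "complex \<Rightarrow> nat \<Rightarrow> (tensor \<Rightarrow> tensor) set" where
  "End_Uq q k = {\<phi> \<in> carrier (EndC k).
     \<forall>u\<in>Uq q. \<forall>f\<in>tpow k. \<phi> (uq_act q k u f) = uq_act q k u (\<phi> f)}"


section \<open>The planar rook algebra and its action\<close>

text \<open>A diagram is the order-preserving partial map from the bottom row to the top row; then
  \<open>\<beta>(d) = dom d\<close>, \<open>\<tau>(d) = ran d\<close>, and concatenation is composition of partial maps.\<close>

definition planar_rook :: "nat \<Rightarrow> (nat \<rightharpoonup> nat) set" where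
  "planar_rook n = {d. dom d \<subseteq> {1..n} \<and> ran d \<subseteq> {1..n} \<and> strict_mono_on (dom d) (the \<circ> d)}"

definition rook_alg :: "nat \<Rightarrow> ((nat \<rightharpoonup> nat) \<Rightarrow>\<^sub>0 complex) ring" where
  "rook_alg n = \<lparr>
     carrier = {a. Poly_Mapping.keys a \<subseteq> planar_rook n},
     mult = (\<lambda>a b. \<Sum>d1\<in>Poly_Mapping.keys a. \<Sum>d2\<in>Poly_Mapping.keys b.
        Poly_Mapping.single (d1 \<circ>\<^sub>m d2) (Poly_Mapping.lookup a d1 * Poly_Mapping.lookup b d2)),
     one = Poly_Mapping.single (Some |` {1..n}) 1,
     zero = 0,
     add = (+)\<rparr>"

definition uvec :: "nat \<Rightarrow> nat set \<Rightarrow> tensor" where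
  "uvec k s = mon (map (\<lambda>i. if i \<in> s then Bx else By) [1..<k])"

definition vvec :: "complex \<Rightarrow> nat \<Rightarrow> nat set \<Rightarrow> tensor" where
  "vvec q k s = gact q k gE (mon [By] * uvec k s)"

text \<open>\<open>v\<^bsub>ds\<^esub>\<close>, with the convention that it is zero when \<open>d\<close> is not defined on all of \<open>s\<close>.\<close>

definition vvec_diag :: "complex \<Rightarrow> nat \<Rightarrow> (nat \<rightharpoonup> nat) \<Rightarrow> nat set \<Rightarrow> tensor" where
  "vvec_diag q k d s = (if s \<subseteq> dom d then vvec q k ((the \<circ> d) ` s) else 0)"

text \<open>\<open>\<rho>\<close> is a linear map from the rook algebra to the linear endomorphisms of the tensor power
  given on diagrams and on the vectors \<open>v\<^sub>s\<close>, \<open>F v\<^sub>s\<close> by the prescribed formulas.\<close>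

definition rook_action ::
    "complex \<Rightarrow> nat \<Rightarrow> (((nat \<rightharpoonup> nat) \<Rightarrow>\<^sub>0 complex) \<Rightarrow> tensor \<Rightarrow> tensor) \<Rightarrow> bool" where
  "rook_action q k \<rho> \<longleftrightarrow>
     \<rho> \<in> carrier (rook_alg (k - 1)) \<rightarrow>\<^sub>E carrier (EndC k) \<and>
     (\<forall>a\<in>carrier (rook_alg (k - 1)). \<forall>b\<in>carrier (rook_alg (k - 1)). \<forall>f\<in>tpow k.
        \<rho> (a + b) f = \<rho> a f + \<rho> b f) \<and>
     (\<forall>c. \<forall>a\<in>carrier (rook_alg (k - 1)). \<forall>f\<in>tpow k. \<rho> (scale c a) f = scale c (\<rho> a f)) \<and>
     (\<forall>d\<in>planar_rook (k - 1). \<forall>s. s \<subseteq> {1..k - 1} \<longrightarrow>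
        \<rho> (Poly_Mapping.single d 1) (vvec q k s) = vvec_diag q k d s \<and>
        \<rho> (Poly_Mapping.single d 1) (gact q k gF (vvec q k s)) = gact q k gF (vvec_diag q k d s))"

section \<open>The action of the quantum group is well defined\<close>

lemma lookup_scale [simp]: "Poly_Mapping.lookup (scale c f) b = c * Poly_Mapping.lookup f b"
  by (simp add: scale_def Poly_Mapping.map.rep_eq when_def)

lemma scale_add: "scale c (f + g) = scale c f + scale c g"
  and scale_add_left: "scale (c + d) f = scale c f + scale d f"
  and scale_diff: "scale c (f - g) = scale c f - scale c g"
  and scale_diff_left: "scale (c - d) f = scale c f - scale d f"
  and scale_scale [simp]: "scale c (scale d f) = scale (c * d) f"
  and scale_zero [simp]: "scale c 0 = 0"
  and scale_zero_left [simp]: "scale 0 f = 0"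
  and scale_one [simp]: "scale 1 f = f"
  and scale_uminus: "scale c (- f) = - scale c f"
  and uminus_scale: "- f = scale (- 1) f"
  by (rule poly_mapping_eqI; simp add: lookup_add lookup_minus algebra_simps)+

lemma scale_sum: "scale c (\<Sum>i\<in>I. f i) = (\<Sum>i\<in>I. scale c (f i))"
  by (induction I rule: infinite_finite_induct) (auto simp: scale_add)

lemma scale_single: "scale c (Poly_Mapping.single b d) = Poly_Mapping.single b (c * d)"
  by (simp add: scale_def)

definition linop :: "(('b \<Rightarrow>\<^sub>0 complex) \<Rightarrow> ('c \<Rightarrow>\<^sub>0 complex)) \<Rightarrow> bool" where
  "linop A \<longleftrightarrow> (\<forall>f g. A (f + g) = A f + A g) \<and> (\<forall>c f. A (scale c f) = scale c (A f))"

lemma linopI: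
  "(\<And>f g. A (f + g) = A f + A g) \<Longrightarrow> (\<And>c f. A (scale c f) = scale c (A f)) \<Longrightarrow> linop A"
  by (simp add: linop_def)

lemma linop_add: "linop A \<Longrightarrow> A (f + g) = A f + A g"
  and linop_scale: "linop A \<Longrightarrow> A (scale c f) = scale c (A f)"
  by (simp_all add: linop_def)

lemma linop_zero: "linop A \<Longrightarrow> A 0 = 0"
  using linop_scale[of A 0 0] by simp

lemma linop_uminus: "linop A \<Longrightarrow> A (- f) = - A f"
  using linop_scale[of A "- 1" f] by (simp add: uminus_scale[symmetric])

lemma linop_diff: "linop A \<Longrightarrow> A (f - g) = A f - A g"
  using linop_add[of A f "- g"] by (simp add: linop_uminus)

lemma linop_sum: "linop A \<Longrightarrow> A (\<Sum>i\<in>I. f i) = (\<Sum>i\<in>I. A (f i))"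
  by (induction I rule: infinite_finite_induct) (auto simp: linop_add linop_zero)

lemma poly_mapping_expand:
  fixes f :: "'b \<Rightarrow>\<^sub>0 complex"
  shows "f = (\<Sum>b\<in>Poly_Mapping.keys f. scale (Poly_Mapping.lookup f b) (Poly_Mapping.single b 1))"
proof (rule poly_mapping_eqI)
  fix b
  have "(\<Sum>a\<in>Poly_Mapping.keys f. Poly_Mapping.lookup f a * Poly_Mapping.lookup (Poly_Mapping.single a 1) b)
      = (\<Sum>a\<in>Poly_Mapping.keys f. if a = b then Poly_Mapping.lookup f a else 0)"
    by (intro sum.cong) (auto simp: lookup_single when_def)
  also have "\<dots> = Poly_Mapping.lookup f b"
    by (simp add: in_keys_iff)
  finally show "Poly_Mapping.lookup f b = Poly_Mapping.lookup
      (\<Sum>b\<in>Poly_Mapping.keys f. scale (Poly_Mapping.lookup f b) (Poly_Mapping.single b 1)) b"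
    by (simp add: lookup_sum)
qed

lemma linop_eqI:
  assumes "linop A" "linop B"
    and "\<And>b. b \<in> Poly_Mapping.keys f \<Longrightarrow> A (Poly_Mapping.single b 1) = B (Poly_Mapping.single b 1)"
  shows "A f = B f"
  by (subst (1 2) poly_mapping_expand[of f])
     (simp add: linop_sum[OF assms(1)] linop_sum[OF assms(2)] linop_scale[OF assms(1)]
       linop_scale[OF assms(2)] assms(3))

lemma lin_ext_superset:
  assumes "finite S" "Poly_Mapping.keys f \<subseteq> S"
  shows "lin_ext g f = (\<Sum>b\<in>S. scale (Poly_Mapping.lookup f b) (g b))"
  unfolding lin_ext_def by (rule sum.mono_neutral_left) (use assms in \<open>auto simp: in_keys_iff\<close>)

lemma linop_lin_ext: "linop (lin_ext g)"
proof (rule linopI)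
  fix f h :: "'a \<Rightarrow>\<^sub>0 complex"
  let ?S = "Poly_Mapping.keys f \<union> Poly_Mapping.keys h"
  have "lin_ext g (f + h) = (\<Sum>b\<in>?S. scale (Poly_Mapping.lookup (f + h) b) (g b))"
    by (rule lin_ext_superset) (auto simp: keys_add)
  moreover have "lin_ext g f = (\<Sum>b\<in>?S. scale (Poly_Mapping.lookup f b) (g b))"
    by (rule lin_ext_superset) auto
  moreover have "lin_ext g h = (\<Sum>b\<in>?S. scale (Poly_Mapping.lookup h b) (g b))"
    by (rule lin_ext_superset) auto
  ultimately show "lin_ext g (f + h) = lin_ext g f + lin_ext g h"
    by (simp add: lookup_add scale_add_left sum.distrib)
next
  fix c and f :: "'a \<Rightarrow>\<^sub>0 complex"
  have "lin_ext g (scale c f) = (\<Sum>b\<in>Poly_Mapping.keys f. scale (Poly_Mapping.lookup (scale c f) b) (g b))"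
    by (rule lin_ext_superset) (auto simp: in_keys_iff)
  then show "lin_ext g (scale c f) = scale c (lin_ext g f)"
    by (simp add: lin_ext_def scale_sum)
qed

lemma lin_ext_single [simp]: "lin_ext g (Poly_Mapping.single b 1) = g b"
  by (simp add: lin_ext_def)

lemma lin_ext_mon [simp]: "lin_ext g (mon w) = g (Word w)"
  by (simp add: mon_def)

lemma mon_mult: "mon v * mon w = mon (v @ w)"
  by (simp add: mon_def mult_single plus_word_def)

lemma mon_Nil: "mon [] = 1"
  by (simp add: mon_def zero_word_def[symmetric])

lemma single_eq_mon: "Poly_Mapping.single w 1 = mon (letters w)"
  by (simp add: mon_def)

lemma scale_mult_left: "scale c (f :: 'a word \<Rightarrow>\<^sub>0 complex) * g = scale c (f * g)"
  by (simp add: scale_def mult_map_scale_conv_mult mult.assoc)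

lemma linop_mult_left: "linop (\<lambda>f :: 'a word \<Rightarrow>\<^sub>0 complex. f * g)"
  by (rule linopI) (simp_all add: distrib_right scale_mult_left)

lemma scale_mult_right: "(f :: 'a word \<Rightarrow>\<^sub>0 complex) * scale c g = scale c (f * g)"
proof -
  have "f * Poly_Mapping.single 0 c = Poly_Mapping.single 0 c * f" for f :: "'a word \<Rightarrow>\<^sub>0 complex"
  proof (rule linop_eqI[where f = f])
    show "linop (\<lambda>f :: 'a word \<Rightarrow>\<^sub>0 complex. Poly_Mapping.single 0 c * f)"
      by (rule linopI) (simp_all add: distrib_left scale_def mult_map_scale_conv_mult
          mult.assoc[symmetric] mult_single mult.commute)
  qed (simp_all add: linop_mult_left mult_single)
  from this[of f] show ?thesis
    by (simp add: scale_def mult_map_scale_conv_mult mult.assoc[symmetric])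
qed

lemma linop_mult_right: "linop (\<lambda>g :: 'a word \<Rightarrow>\<^sub>0 complex. f * g)"
  by (rule linopI) (simp_all add: distrib_left scale_mult_right)

lemma linop_comp: "linop A \<Longrightarrow> linop B \<Longrightarrow> linop (\<lambda>f. A (B f))"
  by (simp add: linop_def)

lemma linop_plus: "linop A \<Longrightarrow> linop B \<Longrightarrow> linop (\<lambda>f. A f + B f)"
  by (simp add: linop_def scale_add algebra_simps)

lemma linop_minus: "linop A \<Longrightarrow> linop B \<Longrightarrow> linop (\<lambda>f. A f - B f)"
  by (simp add: linop_def scale_diff algebra_simps)

lemma linop_neg: "linop A \<Longrightarrow> linop (\<lambda>f. - A f)"
  by (simp add: linop_def scale_uminus algebra_simps)

lemma linop_cmul: "linop A \<Longrightarrow> linop (\<lambda>f. scale c (A f))"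
  by (simp add: linop_def scale_add mult.commute)

lemma linop_id: "linop (\<lambda>f. f)"
  and linop_const_zero: "linop (\<lambda>f. 0)"
  by (simp_all add: linop_def)

lemma linop_foldr: "(\<And>g. linop (G g)) \<Longrightarrow> linop (foldr G w)"
  by (induction w) (simp_all add: linop_def)

lemma linop_op_tensor: "linop (op_tensor A B)"
  unfolding op_tensor_def by (rule linop_lin_ext)

lemma linop_gact: "linop (gact q k g)"
proof (cases k)
  case 0
  then show ?thesis by (cases g) (auto simp: linop_def)
next
  case (Suc m)
  show ?thesis
  proof (cases m)
    case 0
    have "gact q (Suc 0) g
        = lin_ext (\<lambda>w. case letters w of [l] \<Rightarrow> natural_act q g l | _ \<Rightarrow> 0)"
      by (rule ext) simp
    then show ?thesis using Suc 0 linop_lin_ext by metis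
  next
    case (Suc n)
    show ?thesis unfolding \<open>k = Suc m\<close> Suc
      by (rule linopI; cases g)
         (simp_all add: linop_add[OF linop_op_tensor] linop_scale[OF linop_op_tensor] scale_add algebra_simps)
  qed
qed

lemma tpow_zero: "0 \<in> tpow k"
  and tpow_scale: "f \<in> tpow k \<Longrightarrow> scale c f \<in> tpow k"
  and tpow_uminus: "f \<in> tpow k \<Longrightarrow> - f \<in> tpow k"
  and tpow_mon: "length w = k \<Longrightarrow> mon w \<in> tpow k"
  by (auto simp: tpow_def mon_def in_keys_iff)

lemma tpow_add: "f \<in> tpow k \<Longrightarrow> g \<in> tpow k \<Longrightarrow> f + g \<in> tpow k"
  using keys_add[of f g] by (auto simp: tpow_def)

lemma tpow_mult: "f \<in> tpow k \<Longrightarrow> g \<in> tpow m \<Longrightarrow> f * g \<in> tpow (k + m)"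
  using keys_mult[of f g] by (fastforce simp: tpow_def plus_word_def)

lemma tpow_sum: "(\<And>i. i \<in> I \<Longrightarrow> f i \<in> tpow k) \<Longrightarrow> (\<Sum>i\<in>I. f i) \<in> tpow k"
  by (induction I rule: infinite_finite_induct) (auto simp: tpow_zero tpow_add)

lemma lin_ext_tpow:
  "(\<And>b. b \<in> Poly_Mapping.keys f \<Longrightarrow> g b \<in> tpow k) \<Longrightarrow> lin_ext g f \<in> tpow k"
  unfolding lin_ext_def by (intro tpow_sum tpow_scale)

lemma linop_eq_tpow:
  assumes "linop A" "linop B" "f \<in> tpow k" "\<And>w. length w = k \<Longrightarrow> A (mon w) = B (mon w)"
  shows "A f = B f"
  by (rule linop_eqI[OF assms(1,2)])
     (use assms(3,4) in \<open>auto simp: tpow_def single_eq_mon\<close>)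

lemma tpow_1_eqI:
  assumes "linop A" "linop B" "f \<in> tpow (Suc 0)" "\<And>l. A (mon [l]) = B (mon [l])"
  shows "A f = B f"
  by (rule linop_eq_tpow[OF assms(1-3)]) (use assms(4) in \<open>auto simp: length_Suc_conv\<close>)

lemma op_tensor_mult:
  assumes "linop A" "linop B" "u \<in> tpow (Suc 0)"
  shows "op_tensor A B (u * g) = A u * B g"
proof -
  have "op_tensor A B (mon [l] * g) = A (mon [l]) * B g" for l
  proof (rule linop_eqI[of "\<lambda>g. op_tensor A B (mon [l] * g)" "\<lambda>g. A (mon [l]) * B g"])
    show "linop (\<lambda>g. op_tensor A B (mon [l] * g))"
      by (rule linop_comp[OF linop_op_tensor linop_mult_right])
    show "linop (\<lambda>g. A (mon [l]) * B g)"
      by (rule linop_comp[OF linop_mult_right assms(2)])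
  qed (simp add: single_eq_mon mon_mult op_tensor_def)
  then show ?thesis
    by (rule tpow_1_eqI[of "\<lambda>u. op_tensor A B (u * g)" "\<lambda>u. A u * B g", rotated 3])
       (rule linop_comp[OF linop_op_tensor linop_mult_left]
          linop_comp[OF linop_mult_left assms(1)] assms(3))+
qed

lemma op_tensor_tpow:
  assumes "linop A" "linop B"
    and "\<And>u. u \<in> tpow (Suc 0) \<Longrightarrow> A u \<in> tpow (Suc 0)" "\<And>u. u \<in> tpow k \<Longrightarrow> B u \<in> tpow k"
    and "f \<in> tpow (Suc k)"
  shows "op_tensor A B f \<in> tpow (Suc k)"
  unfolding op_tensor_def
proof (rule lin_ext_tpow)
  fix w assume "w \<in> Poly_Mapping.keys f"
  with assms(5) obtain l v where "letters w = l # v" "length v = k"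
    by (auto simp: tpow_def length_Suc_conv dest!: bspec)
  then show "(case letters w of [] \<Rightarrow> 0 | l # v \<Rightarrow> A (mon [l]) * B (mon v)) \<in> tpow (Suc k)"
    using tpow_mult[of "A (mon [l])" "Suc 0" "B (mon v)" k] assms(3,4)
    by (simp add: tpow_mon)
qed

lemma foldr_tpow:
  "(\<And>g f. f \<in> tpow k \<Longrightarrow> G g f \<in> tpow k) \<Longrightarrow> f \<in> tpow k \<Longrightarrow> foldr G w f \<in> tpow k"
  by (induction w) auto

lemma gact_tpow_1: "f \<in> tpow (Suc 0) \<Longrightarrow> gact q (Suc 0) g f \<in> tpow (Suc 0)"
proof -
  have *: "natural_act q g l \<in> tpow (Suc 0)" for l
    by (cases g; cases l) (auto simp: tpow_zero tpow_mon tpow_scale tpow_uminus)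
  assume "f \<in> tpow (Suc 0)"
  then show ?thesis
    by (auto intro!: lin_ext_tpow * simp: tpow_zero split: list.split)
qed

lemma gact_tpow: "f \<in> tpow k \<Longrightarrow> gact q k g f \<in> tpow k"
proof (induction k arbitrary: f g)
  case 0
  then show ?case by (auto simp: tpow_zero)
next
  case (Suc m)
  show ?case
  proof (cases m)
    case 0
    with Suc.prems show ?thesis using gact_tpow_1 by simp
  next
    case (Suc n)
    have "op_tensor (foldr (gact q (Suc 0)) a) (foldr (gact q (Suc n)) b) f \<in> tpow (Suc (Suc n))" for a b
    proof (rule op_tensor_tpow)
      show "foldr (gact q (Suc 0)) a u \<in> tpow (Suc 0)" if "u \<in> tpow (Suc 0)" for u
        using gact_tpow_1 that by (rule foldr_tpow)
      show "foldr (gact q (Suc n)) b u \<in> tpow (Suc n)" if "u \<in> tpow (Suc n)" for u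
        using Suc.IH[unfolded Suc] that by (rule foldr_tpow)
      show "f \<in> tpow (Suc (Suc n))"
        using Suc.prems Suc by simp
    qed (rule linop_foldr[OF linop_gact])+
    then show ?thesis unfolding Suc
      by (cases g) (simp_all only: gact.simps(3) coproduct.simps list.map prod.case sum_list.Cons sum_list.Nil tpow_add tpow_zero)
  qed
qed

lemma gact_tensor:
  assumes "u \<in> tpow (Suc 0)"
  shows "gact q (Suc (Suc n)) gE (u * g)
      = gact q (Suc 0) gE u * gact q (Suc n) gKinv g + gact q (Suc 0) gSigma u * gact q (Suc n) gE g"
    and "gact q (Suc (Suc n)) gF (u * g)
      = gact q (Suc 0) gF u * g
        + gact q (Suc 0) gSigma (gact q (Suc 0) gK u) * gact q (Suc n) gF g"
    and "gact q (Suc (Suc n)) gSigma (u * g)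
      = gact q (Suc 0) gSigma u * gact q (Suc n) gSigma g"
    and "gact q (Suc (Suc n)) (gQ h) (u * g)
      = gact q (Suc 0) (gQ h) u * gact q (Suc n) (gQ h) g"
  using op_tensor_mult[OF linop_foldr linop_foldr assms, of "gact q (Suc 0)" "gact q (Suc n)"] linop_gact
  by (simp_all del: gact.simps(1,2) add: foldr_Cons foldr_Nil)

definition uq_module :: "complex \<Rightarrow> nat \<Rightarrow> (gen \<Rightarrow> tensor \<Rightarrow> tensor) \<Rightarrow> bool" where
  "uq_module q k G \<longleftrightarrow>
     (\<forall>f\<in>tpow k. G (gQ 0) f = f) \<and>
     (\<forall>h h'. \<forall>f\<in>tpow k. G (gQ h) (G (gQ h') f) = G (gQ (h + h')) f) \<and>
     (\<forall>h. \<forall>f\<in>tpow k. G (gQ h) (G gE f) = scale (q powi pairing h alpha) (G gE (G (gQ h) f))) \<and>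
     (\<forall>h. \<forall>f\<in>tpow k. G (gQ h) (G gF f) = scale (q powi (- pairing h alpha)) (G gF (G (gQ h) f))) \<and>
     (\<forall>f\<in>tpow k. G gE (G gF f) + G gF (G gE f) = scale (1 / (q - inverse q)) (G gK f - G gKinv f)) \<and>
     (\<forall>f\<in>tpow k. G gE (G gE f) = 0) \<and>
     (\<forall>f\<in>tpow k. G gF (G gF f) = 0) \<and>
     (\<forall>f\<in>tpow k. G gSigma (G gE f) = - G gE (G gSigma f)) \<and>
     (\<forall>f\<in>tpow k. G gSigma (G gF f) = - G gF (G gSigma f)) \<and>
     (\<forall>h. \<forall>f\<in>tpow k. G gSigma (G (gQ h) f) = G (gQ h) (G gSigma f)) \<and>
     (\<forall>f\<in>tpow k. G gSigma (G gSigma f) = f)"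

lemma linop_eq_tpow_ball:
  assumes "\<And>w. length w = k \<Longrightarrow> A (mon w) = B (mon w)" "linop A" "linop B"
  shows "\<forall>f\<in>tpow k. A f = B f"
  by (intro ballI linop_eq_tpow[OF assms(2,3) _ assms(1)])

lemmas linop_intros = linop_gact linop_comp[OF linop_gact] linop_plus linop_minus linop_neg
  linop_cmul linop_id linop_const_zero

lemma uq_module_basis:
  assumes
    "\<And>w. length w = k \<Longrightarrow> gact q k (gQ 0) (mon w) = mon w"
    and "\<And>w h h'. length w = k \<Longrightarrow> gact q k (gQ h) (gact q k (gQ h') (mon w)) = gact q k (gQ (h + h')) (mon w)"
    and "\<And>w h. length w = k \<Longrightarrow> gact q k (gQ h) (gact q k gE (mon w)) = scale (q powi pairing h alpha) (gact q k gE (gact q k (gQ h) (mon w)))"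
    and "\<And>w h. length w = k \<Longrightarrow> gact q k (gQ h) (gact q k gF (mon w)) = scale (q powi (- pairing h alpha)) (gact q k gF (gact q k (gQ h) (mon w)))"
    and "\<And>w. length w = k \<Longrightarrow> gact q k gE (gact q k gF (mon w)) + gact q k gF (gact q k gE (mon w)) = scale (1 / (q - inverse q)) (gact q k gK (mon w) - gact q k gKinv (mon w))"
    and "\<And>w. length w = k \<Longrightarrow> gact q k gE (gact q k gE (mon w)) = 0"
    and "\<And>w. length w = k \<Longrightarrow> gact q k gF (gact q k gF (mon w)) = 0"
    and "\<And>w. length w = k \<Longrightarrow> gact q k gSigma (gact q k gE (mon w)) = - gact q k gE (gact q k gSigma (mon w))"
    and "\<And>w. length w = k \<Longrightarrow> gact q k gSigma (gact q k gF (mon w)) = - gact q k gF (gact q k gSigma (mon w))"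
    and "\<And>w h. length w = k \<Longrightarrow> gact q k gSigma (gact q k (gQ h) (mon w)) = gact q k (gQ h) (gact q k gSigma (mon w))"
    and "\<And>w. length w = k \<Longrightarrow> gact q k gSigma (gact q k gSigma (mon w)) = mon w"
  shows "uq_module q k (gact q k)"
  unfolding uq_module_def
  by (intro conjI allI; rule linop_eq_tpow_ball, erule assms; intro linop_intros)

lemma uq_moduleD:
  assumes "uq_module q k G" "f \<in> tpow k"
  shows "G (gQ 0) f = f"
    and "G (gQ h) (G (gQ h') f) = G (gQ (h + h')) f"
    and "G (gQ h) (G gE f) = scale (q powi pairing h alpha) (G gE (G (gQ h) f))"
    and "G (gQ h) (G gF f) = scale (q powi (- pairing h alpha)) (G gF (G (gQ h) f))"
    and "G gE (G gF f) + G gF (G gE f) = scale (1 / (q - inverse q)) (G gK f - G gKinv f)"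
    and "G gE (G gE f) = 0" and "G gF (G gF f) = 0"
    and "G gSigma (G gE f) = - G gE (G gSigma f)"
    and "G gSigma (G gF f) = - G gF (G gSigma f)"
    and "G gSigma (G (gQ h) f) = G (gQ h) (G gSigma f)"
    and "G gSigma (G gSigma f) = f"
  using assms unfolding uq_module_def by blast+

lemma pairing_K [simp]: "pairing (h1 + h2) alpha = 0" "pairing (- (h1 + h2)) alpha = 0"
  by (simp_all add: pairing_def alpha_def eps1_def eps2_def h1_def h2_def)

lemma uq_moduleD_K:
  assumes "uq_module q k G" "f \<in> tpow k"
  shows "G gK (G gE f) = G gE (G gK f)" and "G gKinv (G gE f) = G gE (G gKinv f)"
    and "G gK (G gF f) = G gF (G gK f)" and "G gKinv (G gF f) = G gF (G gKinv f)"
    and "G gSigma (G gK f) = G gK (G gSigma f)" and "G gSigma (G gKinv f) = G gKinv (G gSigma f)"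
    and "G (gQ h) (G gK f) = G gK (G (gQ h) f)" and "G (gQ h) (G gKinv f) = G gKinv (G (gQ h) f)"
  using uq_moduleD[OF assms]
  by (simp_all only: gK_def gKinv_def pairing_K power_int_0_right minus_zero scale_one add.commute)

lemma uq_module_natural:
  assumes "q \<noteq> 0" "q \<noteq> inverse q"
  shows "uq_module q (Suc 0) (gact q (Suc 0))"
proof -
  have singleton: thesis if "length w = Suc 0" "\<And>l. w = [l] \<Longrightarrow> thesis" for w :: "basis list" and thesis
    using that by (auto simp: length_Suc_conv)
  have ne: "q - inverse q \<noteq> 0" using assms by simp
  have pw: "q powi (b - a) * q powi a = q powi b" for a b
    using assms(1) power_int_add[of q "b - a" a] by simp
  have lin1: "gact q (Suc 0) g (mon [l]) = natural_act q g l" for g l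
    by simp
  show ?thesis
    using ne assms(1)
    by (intro uq_module_basis; elim singleton; hypsubst; rename_tac l; case_tac l;
        simp del: gact.simps split_paired_All
          add: linop_gact linop_zero linop_scale linop_uminus lin1 pairing_def eps1_def eps2_def
            alpha_def h1_def h2_def gK_def gKinv_def power_int_add power_int_minus zero_prod_def
            scale_diff_left[symmetric];
        simp add: pw scale_uminus; simp add: mult.commute)
qed

lemma uq_module_tensor:
  assumes "q \<noteq> 0" "q \<noteq> inverse q" and "uq_module q (Suc n) (gact q (Suc n))"
  shows "uq_module q (Suc (Suc n)) (gact q (Suc (Suc n)))"
proof -
  define G where "G = gact q (Suc 0)"
  define H where "H = gact q (Suc n)"
  define T where "T = gact q (Suc (Suc n))"
  have lG: "linop (G g)" and lH: "linop (H g)" and lT: "linop (T g)" for g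
    by (simp_all only: G_def H_def T_def linop_gact)
  note lins = linop_zero[OF lG] linop_zero[OF lH] linop_scale[OF lG] linop_scale[OF lH]
    linop_uminus[OF lG] linop_uminus[OF lH]
  have Gt: "G g v \<in> tpow (Suc 0)" if "v \<in> tpow (Suc 0)" for g v
    using that unfolding G_def by (rule gact_tpow)
  have Gm: "uq_module q (Suc 0) G" unfolding G_def by (rule uq_module_natural[OF assms(1,2)])
  have Hm: "uq_module q (Suc n) H" unfolding H_def by (rule assms(3))
  have T: "T gE (a * b) = G gE a * H gKinv b + G gSigma a * H gE b"
      "T gF (a * b) = G gF a * b + G gSigma (G gK a) * H gF b"
      "T gSigma (a * b) = G gSigma a * H gSigma b"
      "T (gQ h) (a * b) = G (gQ h) a * H (gQ h) b"
      "T gK (a * b) = G gK a * H gK b" "T gKinv (a * b) = G gKinv a * H gKinv b"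
    if "a \<in> tpow (Suc 0)" for a b h
    unfolding G_def H_def T_def
    by (fact gact_tensor[OF that] gact_tensor(4)[OF that, of q n "h1 + h2" b, folded gK_def]
        gact_tensor(4)[OF that, of q n "- (h1 + h2)" b, folded gKinv_def])+
  have main:
      "T (gQ 0) (mon w) = mon w"
      "T (gQ h) (T (gQ h') (mon w)) = T (gQ (h + h')) (mon w)"
      "T (gQ h) (T gE (mon w)) = scale (q powi pairing h alpha) (T gE (T (gQ h) (mon w)))"
      "T (gQ h) (T gF (mon w)) = scale (q powi (- pairing h alpha)) (T gF (T (gQ h) (mon w)))"
      "T gE (T gF (mon w)) + T gF (T gE (mon w)) = scale (1 / (q - inverse q)) (T gK (mon w) - T gKinv (mon w))"
      "T gE (T gE (mon w)) = 0"
      "T gF (T gF (mon w)) = 0"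
      "T gSigma (T gE (mon w)) = - T gE (T gSigma (mon w))"
      "T gSigma (T gF (mon w)) = - T gF (T gSigma (mon w))"
      "T gSigma (T (gQ h) (mon w)) = T (gQ h) (T gSigma (mon w))"
      "T gSigma (T gSigma (mon w)) = mon w"
    if len: "length w = Suc (Suc n)" for w h h'
  proof -
    obtain l v where w: "w = l # v" "length v = Suc n"
      using len by (auto simp: length_Suc_conv)
    define u where "u = mon [l]"
    define t where "t = mon v"
    have ut: "mon w = u * t" by (simp add: u_def t_def w mon_mult)
    have u: "u \<in> tpow (Suc 0)" and t: "t \<in> tpow (Suc n)"
      by (simp_all add: u_def t_def w tpow_mon)
    note Gu = uq_moduleD[OF Gm u] uq_moduleD_K[OF Gm u] 
    note Gv = uq_moduleD[OF Gm Gt[OF u]] uq_moduleD_K[OF Gm Gt[OF u]] 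
    note Ht = uq_moduleD[OF Hm t] uq_moduleD_K[OF Hm t] 
    note S = T[OF u] T[OF Gt[OF u]] T[OF Gt[OF Gt[OF u]]] linop_add[OF lT]
    have r1: "T (gQ 0) (u * t) = u * t"
      by (simp only: S Gu(1) Ht(1))
    have r2: "T (gQ h) (T (gQ h') (u * t)) = T (gQ (h + h')) (u * t)" for h h'
      by (simp only: S Gu(2) Ht(2))
    have r3: "T (gQ h) (T gE (u * t)) = scale (q powi pairing h alpha) (T gE (T (gQ h) (u * t)))" for h
      by (simp only: S Gu(3) Ht(3) Ht(19) Gu(10) scale_add scale_mult_left scale_mult_right)
    have r4: "T (gQ h) (T gF (u * t)) = scale (q powi (- pairing h alpha)) (T gF (T (gQ h) (u * t)))" for h
      by (simp only: S Gu(4) Ht(4) Gv(10)[symmetric] Gu(18)[symmetric] scale_add scale_mult_left scale_mult_right)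
    have r5: "T gE (T gF (u * t)) + T gF (T gE (u * t))
        = scale (1 / (q - inverse q)) (T gK (u * t) - T gKinv (u * t))"
    proof -
      have a: "G gE (G gSigma (G gK u)) = - G gSigma (G gK (G gE u))"
        by (simp only: Gv(8) Gu(12) minus_minus)
      have b: "G gSigma (G gK (G gSigma u)) = G gK u"
        by (simp only: Gv(16) Gu(11))
      have c: "G gF (G gSigma u) = - G gSigma (G gF u)"
        by (simp only: Gu(9) minus_minus)
      have "T gE (T gF (u * t)) + T gF (T gE (u * t))
        = (G gE (G gF u) + G gF (G gE u)) * H gKinv t + G gK u * (H gE (H gF t) + H gF (H gE t))"
        by (simp only: S a b c Gv(11) Ht(15)) (simp add: algebra_simps)
      also have "\<dots> = scale (1 / (q - inverse q)) (G gK u * H gK t - G gKinv u * H gKinv t)"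
        unfolding Gu(5) Ht(5) scale_mult_left scale_mult_right scale_add[symmetric]
        by (simp add: algebra_simps)
      finally show ?thesis by (simp only: S)
    qed
    have r6: "T gE (T gE (u * t)) = 0"
      by (simp only: S Gu(6) Ht(6) Gu(8) Ht(13)) simp
    have r7: "T gF (T gF (u * t)) = 0"
    proof -
      have a: "G gF (G gSigma (G gK u)) = - G gSigma (G gK (G gF u))"
        by (simp only: Gv(9) Gu(14) minus_minus)
      show ?thesis by (simp only: S Gu(7) Ht(7) a) simp
    qed
    have r8: "T gSigma (T gE (u * t)) = - T gE (T gSigma (u * t))"
      by (simp only: S Gu(8) Ht(8) Ht(17)) simp
    have r9: "T gSigma (T gF (u * t)) = - T gF (T gSigma (u * t))"
      by (simp only: S Gu(9) Ht(9) Gu(16)) simp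
    have r10: "T gSigma (T (gQ h) (u * t)) = T (gQ h) (T gSigma (u * t))" for h
      by (simp only: S Gu(10) Ht(10))
    have r11: "T gSigma (T gSigma (u * t)) = u * t"
      by (simp only: S Gu(11) Ht(11))
    show "T (gQ 0) (mon w) = mon w" unfolding ut by (fact r1)
    show "T (gQ h) (T (gQ h') (mon w)) = T (gQ (h + h')) (mon w)" unfolding ut by (fact r2)
    show "T (gQ h) (T gE (mon w)) = scale (q powi pairing h alpha) (T gE (T (gQ h) (mon w)))" unfolding ut by (fact r3)
    show "T (gQ h) (T gF (mon w)) = scale (q powi (- pairing h alpha)) (T gF (T (gQ h) (mon w)))" unfolding ut by (fact r4)
    show "T gE (T gF (mon w)) + T gF (T gE (mon w)) = scale (1 / (q - inverse q)) (T gK (mon w) - T gKinv (mon w))" unfolding ut by (fact r5)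
    show "T gE (T gE (mon w)) = 0" unfolding ut by (fact r6)
    show "T gF (T gF (mon w)) = 0" unfolding ut by (fact r7)
    show "T gSigma (T gE (mon w)) = - T gE (T gSigma (mon w))" unfolding ut by (fact r8)
    show "T gSigma (T gF (mon w)) = - T gF (T gSigma (mon w))" unfolding ut by (fact r9)
    show "T gSigma (T (gQ h) (mon w)) = T (gQ h) (T gSigma (mon w))" unfolding ut by (fact r10)
    show "T gSigma (T gSigma (mon w)) = mon w" unfolding ut by (fact r11)
  qed
  show ?thesis
    by (rule uq_module_basis; erule main[unfolded T_def])
qed

lemma uq_module_gact:
  assumes "q \<noteq> 0" "q \<noteq> inverse q"
  shows "uq_module q k (gact q k)"
proof (induction k)
  case 0
  show ?case
    by (rule uq_module_basis) (simp_all add: gK_def gKinv_def)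
next
  case (Suc m)
  show ?case
  proof (cases m)
    case 0
    show ?thesis unfolding 0 by (rule uq_module_natural[OF assms])
  next
    case (Suc n)
    show ?thesis using Suc.IH unfolding Suc by (rule uq_module_tensor[OF assms])
  qed
qed

lemma linop_free_act: "linop (free_act q k t)"
proof (rule linopI)
  have l: "linop (foldr (gact q k) w)" for w
    by (intro linop_foldr linop_gact)
  show "free_act q k t (f + g) = free_act q k t f + free_act q k t g" for f g
    by (simp add: free_act_def lin_ext_def linop_add[OF l] scale_add sum.distrib)
  show "free_act q k t (scale c f) = scale c (free_act q k t f)" for c f
    by (simp add: free_act_def lin_ext_def linop_scale[OF l] scale_sum mult.commute)
qed

lemma linop_free_act_left: "linop (\<lambda>t. free_act q k t f)"
  unfolding free_act_def by (rule linop_lin_ext)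

lemma free_act_mon: "free_act q k (mon w) f = foldr (gact q k) w f"
  by (simp add: free_act_def)

lemma free_act_gen [simp]: "free_act q k (gen g) f = gact q k g f"
  by (simp add: gen_def free_act_mon)

lemma free_act_one [simp]: "free_act q k 1 f = f"
  by (simp add: mon_Nil[symmetric] free_act_mon)

lemma free_act_tpow: "f \<in> tpow k \<Longrightarrow> free_act q k t f \<in> tpow k"
  unfolding free_act_def by (intro lin_ext_tpow foldr_tpow gact_tpow)

lemma free_act_mult: "free_act q k (s * t) f = free_act q k s (free_act q k t f)"
proof -
  have "free_act q k (mon v * t) f = free_act q k (mon v) (free_act q k t f)" for v
  proof (rule linop_eqI[of "\<lambda>t. free_act q k (mon v * t) f" "\<lambda>t. free_act q k (mon v) (free_act q k t f)"])
    show "linop (\<lambda>t. free_act q k (mon v * t) f)"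
      by (rule linop_comp[OF linop_free_act_left linop_mult_right])
    show "linop (\<lambda>t. free_act q k (mon v) (free_act q k t f))"
      by (rule linop_comp[OF linop_free_act linop_free_act_left])
  qed (simp add: single_eq_mon mon_mult free_act_mon del: gact.simps)
  note mon_case = this
  show ?thesis
  proof (rule linop_eqI[of "\<lambda>s. free_act q k (s * t) f" "\<lambda>s. free_act q k s (free_act q k t f)"])
    show "linop (\<lambda>s. free_act q k (s * t) f)"
      by (rule linop_comp[OF linop_free_act_left linop_mult_left])
  qed (simp_all only: linop_free_act_left single_eq_mon mon_case)
qed

lemma free_act_rel:
  assumes "uq_rel q a b" "q \<noteq> 0" "q \<noteq> inverse q" "f \<in> tpow k"
  shows "free_act q k a f = free_act q k b f"
proof -
  note L = linop_add[OF linop_free_act_left] linop_scale[OF linop_free_act_left]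
    linop_diff[OF linop_free_act_left] linop_uminus[OF linop_free_act_left]
    linop_zero[OF linop_free_act_left]
  show ?thesis
    using assms(1)
    by cases (simp_all only: L free_act_mult free_act_gen free_act_one
        uq_moduleD[OF uq_module_gact[OF assms(2,3)] assms(4)])
qed

lemma free_act_ideal:
  assumes "a \<in> uq_ideal q" "q \<noteq> 0" "q \<noteq> inverse q" "f \<in> tpow k"
  shows "free_act q k a f = 0"
  using assms(1,4)
proof (induction arbitrary: f)
  case (rel a b)
  then show ?case using free_act_rel assms(2,3) by (simp add: linop_diff[OF linop_free_act_left])
qed (simp_all add: linop_zero[OF linop_free_act_left] linop_add[OF linop_free_act_left]
    free_act_mult linop_zero[OF linop_free_act] free_act_tpow)

lemma uq_ideal_uminus: "a \<in> uq_ideal q \<Longrightarrow> - a \<in> uq_ideal q"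
  using uq_ideal.left[of a q "- 1"] by simp

lemma equiv_uq_cong: "equiv UNIV (uq_cong q)"
proof (rule equivI)
  show "sym (uq_cong q)"
  proof (rule symI)
    fix a b assume "(a, b) \<in> uq_cong q"
    then show "(b, a) \<in> uq_cong q"
      using uq_ideal_uminus[of "a - b" q] by (simp add: uq_cong_def)
  qed
  show "trans (uq_cong q)"
  proof (rule transI)
    fix a b c assume "(a, b) \<in> uq_cong q" "(b, c) \<in> uq_cong q"
    then show "(a, c) \<in> uq_cong q"
      using uq_ideal.add[of "a - b" q "b - c"] by (simp add: uq_cong_def)
  qed
qed (auto simp: refl_on_def uq_cong_def uq_ideal.zero)

lemma uq_act_class:
  assumes "q \<noteq> 0" "q \<noteq> inverse q" "f \<in> tpow k"
  shows "uq_act q k (uq_cong q `` {t}) f = free_act q k t f"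
proof -
  define t' where "t' = (SOME t'. t' \<in> uq_cong q `` {t})"
  have "t' \<in> uq_cong q `` {t}"
    unfolding t'_def by (rule someI[of _ t]) (auto simp: uq_cong_def uq_ideal.zero)
  then have "free_act q k (t - t') f = 0"
    using free_act_ideal assms by (auto simp: uq_cong_def)
  then show ?thesis
    by (simp add: uq_act_def t'_def linop_diff[OF linop_free_act_left])
qed

lemma gKinv_act:
  assumes "q \<noteq> 0" "f \<in> tpow k"
  shows "gact q k gKinv f = scale (q powi (- int k)) f"
  using assms(2)
proof (induction k arbitrary: f)
  case 0
  then show ?case by (simp add: gKinv_def)
next
  case (Suc m)
  have one: "gact q (Suc 0) gKinv (mon [l]) = scale (inverse q) (mon [l])" for l
    by (cases l) (simp_all add: gKinv_def h1_def h2_def pairing_def eps1_def eps2_def)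
  have lin: "linop (scale c)" for c :: complex
    by (rule linop_cmul[OF linop_id])
  show ?case
  proof (rule linop_eq_tpow[OF linop_gact lin Suc.prems])
    fix w :: "basis list" assume "length w = Suc m"
    then obtain l v where w: "w = l # v" "length v = m" by (auto simp: length_Suc_conv)
    show "gact q (Suc m) gKinv (mon w) = scale (q powi (- int (Suc m))) (mon w)"
    proof (cases m)
      case 0
      then show ?thesis using w one[of l] by simp
    next
      case (Suc n)
      have "mon w = mon [l] * mon v" by (simp add: w mon_mult)
      then have "gact q (Suc m) gKinv (mon w)
          = gact q (Suc 0) gKinv (mon [l]) * gact q m gKinv (mon v)"
        unfolding Suc gKinv_def by (simp only: gact_tensor(4) tpow_mon length_Cons list.size)
      also have "\<dots> = scale (q powi (- int (Suc m))) (mon w)"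
        unfolding one Suc.IH[OF tpow_mon[OF w(2)]] using assms(1) power_int_add[of q "- int m" "- 1"]
        by (simp add: w mon_mult scale_mult_left scale_mult_right add.commute)
      finally show ?thesis .
    qed
  qed
qed

text \<open>The closed formula \<open>v\<^sub>s = q\<^sup>1\<^sup>-\<^sup>k x \<otimes> u\<^sub>s - y \<otimes> E u\<^sub>s\<close>.\<close>

lemma vvec_eq:
  assumes "k \<ge> 1" "q \<noteq> 0"
  shows "vvec q k s = scale (q powi (1 - int k)) (mon [Bx] * uvec k s)
    - mon [By] * gact q (k - 1) gE (uvec k s)"
proof (cases "k = 1")
  case True
  then show ?thesis by (simp add: vvec_def uvec_def mon_Nil)
next
  case False
  with assms(1) obtain n where k: "k = Suc (Suc n)"
    by (metis Suc_le_D One_nat_def not0_implies_Suc)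
  have u: "uvec k s \<in> tpow (Suc n)" by (simp add: uvec_def tpow_mon k)
  have y: "mon [By] \<in> tpow (Suc 0)" by (simp add: tpow_mon)
  have "gact q (Suc 0) gE (mon [By]) = mon [Bx]" "gact q (Suc 0) gSigma (mon [By]) = - mon [By]"
    by simp_all
  then show ?thesis
    using gKinv_act[OF assms(2) u] unfolding vvec_def k gact_tensor(1)[OF y]
    by (simp add: scale_mult_right del: gact.simps)
qed

end

theory Submission
  imports Defs "HOL-Library.Infinite_Set"
begin

text \<open>
  Write \<open>k = n + 1\<close>.  The idea is that the map \<open>u \<mapsto> E (y \<otimes> u)\<close> controls the whole module: it
  embeds \<open>V\<^sup>\<otimes>\<^sup>n\<close> into \<open>V\<^sup>\<otimes>\<^sup>k\<close>, because the coefficient of \<open>x \<otimes> u\<close> in \<open>E (y \<otimes> u)\<close> is a power of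
  \<open>q\<close>, and its image is the whole image of \<open>E\<close>, because \<open>E\<^sup>2 = 0\<close> forces \<open>E (x \<otimes> u)\<close> to be a multiple
  of \<open>E (y \<otimes> E u)\<close> (\<open>x_part_raise\<close>, \<open>raise_x_part\<close>).  On \<open>V\<^sup>\<otimes>\<^sup>k\<close> the element \<open>K\<close> is the scalar \<open>q\<^sup>k\<close>, so
  \<open>EF + FE\<close> is the scalar \<open>[k]\<close>, which is nonzero as \<open>q\<close> is not a root of unity.  Hence
  \<open>f = [k]\<^sup>-\<^sup>1 (E F f + F E f)\<close>, and \<open>V\<^sup>\<otimes>\<^sup>k\<close> is the direct sum of the image \<open>M\<close> of the embedding and of
  \<open>F M\<close>, two copies of \<open>V\<^sup>\<otimes>\<^sup>n\<close> (\<open>raise_decomposition\<close>).  The vectors \<open>v\<^sub>s\<close> and \<open>F v\<^sub>s\<close> are the copies of the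
  word basis \<open>u\<^sub>s\<close>, so the prescribed formulas say exactly that the rook algebra acts on both copies
  by \<open>d u\<^sub>s = u\<^bsub>ds\<^esub>\<close>; this gives existence and uniqueness of the action and its multiplicativity.
  
  An endomorphism commuting with \<open>E\<close> and \<open>F\<close> preserves \<open>M\<close> and acts on \<open>F M\<close> in the same way,
  so it amounts to one operator \<open>\<Phi>\<close> on \<open>V\<^sup>\<otimes>\<^sup>n\<close>.  Commuting with \<open>q\<^sup>h\<^sup>1\<close>, whose eigenvalues \<open>q\<^sup>|\<^sup>s\<^sup>|\<close> on the
  \<open>u\<^sub>s\<close> separate sizes, means that \<open>\<Phi>\<close> is block diagonal with respect to \<open>|s|\<close>; the other Cartan
  generators impose nothing more, as their eigenvalues depend on \<open>|s|\<close> only.  It remains to see that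
  the rook algebra is faithful on \<open>V\<^sup>\<otimes>\<^sup>n\<close> and fills all block-diagonal matrices.  Both facts are
  triangularity: a planar diagram is determined by its domain and its range, and \<open>d\<close> acts as the sum over
  \<open>s \<subseteq> dom d\<close> of the matrix units from \<open>s\<close> to \<open>ds\<close>, with leading term at \<open>s = dom d\<close>
  (\<open>rook_op_faithful\<close>, \<open>rook_matrix_unit\<close>).
\<close>

declare gact.simps [simp del]

section \<open>Linear maps on spans of basis vectors\<close>

text \<open>
  Elements of \<open>tpow k\<close>, of the rook algebra and of the free algebra are all finite combinations of
  basis vectors indexed by some set \<open>S\<close>.  Induction in this form also serves maps that are linear
  only on that span, such as members of \<open>EndC k\<close>, which are undefined elsewhere.
\<close>

lemma keys_subset_induct [consumes 1, case_names zero add scale single]: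
  fixes f :: "'b \<Rightarrow>\<^sub>0 complex"
  assumes "Poly_Mapping.keys f \<subseteq> S"
    and "Q 0"
    and "\<And>f g. Poly_Mapping.keys f \<subseteq> S \<Longrightarrow> Poly_Mapping.keys g \<subseteq> S \<Longrightarrow> Q f \<Longrightarrow> Q g \<Longrightarrow> Q (f + g)"
    and "\<And>c f. Poly_Mapping.keys f \<subseteq> S \<Longrightarrow> Q f \<Longrightarrow> Q (scale c f)"
    and "\<And>b. b \<in> S \<Longrightarrow> Q (Poly_Mapping.single b 1)"
  shows "Q f"
proof -
  let ?t = "\<lambda>b. scale (Poly_Mapping.lookup f b) (Poly_Mapping.single b 1)"
  have keys_t: "Poly_Mapping.keys (?t b) \<subseteq> S" if "b \<in> S" for b
    using that by (auto simp: scale_single)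
  have "T \<subseteq> S \<Longrightarrow> Q (\<Sum>b\<in>T. ?t b) \<and> Poly_Mapping.keys (\<Sum>b\<in>T. ?t b) \<subseteq> S" if "finite T" for T
    using that
  proof (induction T)
    case empty
    then show ?case using assms(2) by simp
  next
    case (insert b T)
    have "Q (?t b)" using insert.prems by (intro assms(4,5)) auto
    then show ?case
      using insert keys_t[of b] keys_add[of "?t b" "\<Sum>b\<in>T. ?t b"]
      by (auto intro!: assms(3))
  qed
  from this[of "Poly_Mapping.keys f"] show ?thesis
    using assms(1) by (subst poly_mapping_expand[of f]) auto
qed

lemma tpow_induct [consumes 1, case_names zero add scale mon]:
  assumes "f \<in> tpow k" and "Q 0"
    and "\<And>f g. f \<in> tpow k \<Longrightarrow> g \<in> tpow k \<Longrightarrow> Q f \<Longrightarrow> Q g \<Longrightarrow> Q (f + g)"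
    and "\<And>c f. f \<in> tpow k \<Longrightarrow> Q f \<Longrightarrow> Q (scale c f)"
    and "\<And>w. length w = k \<Longrightarrow> Q (mon w)"
  shows "Q f"
proof -
  have tpow_iff: "f \<in> tpow k \<longleftrightarrow> Poly_Mapping.keys f \<subseteq> {w. length (letters w) = k}" for f
    by (auto simp: tpow_def)
  show ?thesis
    using assms(1) unfolding tpow_iff
    by (rule keys_subset_induct) (use assms(2-5) in \<open>auto simp: tpow_iff single_eq_mon\<close>)
qed

lemma EndC_tpow: "\<phi> \<in> carrier (EndC k) \<Longrightarrow> f \<in> tpow k \<Longrightarrow> \<phi> f \<in> tpow k"
  and EndC_add: "\<phi> \<in> carrier (EndC k) \<Longrightarrow> f \<in> tpow k \<Longrightarrow> g \<in> tpow k \<Longrightarrow> \<phi> (f + g) = \<phi> f + \<phi> g"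
  and EndC_scale: "\<phi> \<in> carrier (EndC k) \<Longrightarrow> f \<in> tpow k \<Longrightarrow> \<phi> (scale c f) = scale c (\<phi> f)"
  by (auto simp: EndC_def)

lemma EndC_zero: "\<phi> \<in> carrier (EndC k) \<Longrightarrow> \<phi> 0 = 0"
  using EndC_scale[of \<phi> k 0 0] by (simp add: tpow_zero)

lemma EndC_eqI:
  assumes "\<phi> \<in> carrier (EndC k)" "\<psi> \<in> carrier (EndC k)" "\<And>f. f \<in> tpow k \<Longrightarrow> \<phi> f = \<psi> f"
  shows "\<phi> = \<psi>"
  using assms by (auto simp: EndC_def intro: PiE_ext)

lemma EndC_restrict:
  assumes "linop A" "\<And>f. f \<in> tpow k \<Longrightarrow> A f \<in> tpow k"
  shows "restrict A (tpow k) \<in> carrier (EndC k)"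
  using assms by (auto simp: EndC_def tpow_add tpow_scale linop_add linop_scale)

lemma EndC_comp:
  assumes "\<phi> \<in> carrier (EndC k)" "linop A" "\<And>f. f \<in> tpow k \<Longrightarrow> A f \<in> tpow k"
  shows "(\<lambda>f\<in>tpow k. \<phi> (A f)) \<in> carrier (EndC k)" "(\<lambda>f\<in>tpow k. A (\<phi> f)) \<in> carrier (EndC k)"
  using assms by (auto simp: EndC_def tpow_add tpow_scale linop_add linop_scale Pi_iff PiE_iff)

text \<open>
  The set of elements of the free algebra whose action commutes with \<open>\<phi>\<close> is closed under sums,
  scalars and products, so it is everything once it contains the generators.
\<close>

lemma End_Uq_iff:
  assumes "q \<noteq> 0" "q \<noteq> inverse q"
  shows "\<phi> \<in> End_Uq q k \<longleftrightarrow>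
    \<phi> \<in> carrier (EndC k) \<and> (\<forall>g. \<forall>f\<in>tpow k. \<phi> (gact q k g f) = gact q k g (\<phi> f))"
proof (intro iffI conjI allI ballI)
  assume "\<phi> \<in> End_Uq q k"
  then show "\<phi> \<in> carrier (EndC k)" by (simp add: End_Uq_def)
next
  fix g f assume \<phi>: "\<phi> \<in> End_Uq q k" and f: "f \<in> tpow k"
  have "uq_cong q `` {gen g} \<in> Uq q" by (simp add: Uq_def quotientI)
  with \<phi> f have "\<phi> (uq_act q k (uq_cong q `` {gen g}) f) = uq_act q k (uq_cong q `` {gen g}) (\<phi> f)"
    by (simp add: End_Uq_def)
  moreover have "\<phi> f \<in> tpow k" using \<phi> f by (simp add: End_Uq_def EndC_tpow)
  ultimately show "\<phi> (gact q k g f) = gact q k g (\<phi> f)"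
    using f by (simp add: uq_act_class[OF assms])
next
  assume R: "\<phi> \<in> carrier (EndC k) \<and> (\<forall>g. \<forall>f\<in>tpow k. \<phi> (gact q k g f) = gact q k g (\<phi> f))"
  then have \<phi>: "\<phi> \<in> carrier (EndC k)"
    and comm: "\<And>g f. f \<in> tpow k \<Longrightarrow> \<phi> (gact q k g f) = gact q k g (\<phi> f)" by auto
  have word: "\<phi> (foldr (gact q k) w f) = foldr (gact q k) w (\<phi> f)" if "f \<in> tpow k" for w f
    using that by (induction w) (simp_all add: comm foldr_tpow gact_tpow)
  have free: "\<phi> (free_act q k t f) = free_act q k t (\<phi> f)" if f: "f \<in> tpow k" for t f
    using subset_UNIV[of "Poly_Mapping.keys t"]
  proof (induction rule: keys_subset_induct)
    case zero
    then show ?case by (simp add: linop_zero[OF linop_free_act_left] EndC_zero[OF \<phi>])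
  next
    case (add s t)
    then show ?case
      by (simp add: linop_add[OF linop_free_act_left] EndC_add[OF \<phi>] free_act_tpow f)
  next
    case (scale c t)
    then show ?case
      by (simp add: linop_scale[OF linop_free_act_left] EndC_scale[OF \<phi>] free_act_tpow f)
  next
    case (single w)
    then show ?case by (simp add: single_eq_mon free_act_mon word f)
  qed
  have "\<phi> (uq_act q k u f) = uq_act q k u (\<phi> f)" if u: "u \<in> Uq q" "f \<in> tpow k" for u f
  proof -
    obtain t where "u = uq_cong q `` {t}"
      using u(1) by (auto simp: Uq_def elim: quotientE)
    then show ?thesis
      using u(2) by (simp add: uq_act_class[OF assms] free EndC_tpow[OF \<phi>])
  qed
  with \<phi> show "\<phi> \<in> End_Uq q k" by (simp add: End_Uq_def)
qed

section \<open>Tensor factors and weights\<close>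

text \<open>
  This makes the coproduct formulas below uniform: for \<open>n = 0\<close> they hold by the counit axiom, since
  \<open>V\<^sup>\<otimes>\<^sup>0\<close> consists of scalars.
\<close>

lemma tpow_0: "f \<in> tpow 0 \<Longrightarrow> \<exists>c. f = scale c 1"
proof (induction rule: tpow_induct)
  case zero
  show ?case by (rule exI[of _ 0]) simp
next
  case (mon w)
  then show ?case by (intro exI[of _ 1]) (simp add: mon_Nil)
qed (metis scale_add_left, metis scale_scale)

lemma gact_split:
  assumes "u \<in> tpow (Suc 0)" "g \<in> tpow n"
  shows "gact q (Suc n) gE (u * g)
      = gact q (Suc 0) gE u * gact q n gKinv g + gact q (Suc 0) gSigma u * gact q n gE g"
    and "gact q (Suc n) gSigma (u * g) = gact q (Suc 0) gSigma u * gact q n gSigma g"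
    and "gact q (Suc n) (gQ h) (u * g) = gact q (Suc 0) (gQ h) u * gact q n (gQ h) g"
proof (atomize(full), cases n)
  case 0
  have zero: "gact q 0 gKinv 1 = 1" "gact q 0 gSigma 1 = 1" "gact q 0 (gQ h) 1 = 1" "gact q 0 gE 1 = 0"
    by (simp_all add: gact.simps gKinv_def)
  obtain c where "g = scale c 1" using assms(2) tpow_0 unfolding 0 by blast
  then show "gact q (Suc n) gE (u * g)
      = gact q (Suc 0) gE u * gact q n gKinv g + gact q (Suc 0) gSigma u * gact q n gE g \<and>
    gact q (Suc n) gSigma (u * g) = gact q (Suc 0) gSigma u * gact q n gSigma g \<and>
    gact q (Suc n) (gQ h) (u * g) = gact q (Suc 0) (gQ h) u * gact q n (gQ h) g"
    by (simp add: 0 zero linop_scale[OF linop_gact] scale_mult_right)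
qed (simp add: gact_tensor[OF assms(1)])

lemma gact_one_mon: "gact q (Suc 0) g (mon [l]) = natural_act q g l"
  by (simp add: gact.simps)

text \<open>
  The eigenvalues of \<open>q\<^sup>h\<close> and \<open>\<sigma>\<close> on \<open>x\<close> and \<open>y\<close>.  The nilpotent generators get the default 0.
\<close>

fun cartan_weight :: "complex \<Rightarrow> gen \<Rightarrow> basis \<Rightarrow> complex" where
  "cartan_weight q (gQ h) Bx = q powi pairing h eps1"
| "cartan_weight q (gQ h) By = q powi pairing h eps2"
| "cartan_weight q gSigma Bx = 1"
| "cartan_weight q gSigma By = - 1"
| "cartan_weight q _ _ = 0"

lemma gact_cartan_mon:
  assumes "g \<noteq> gE" "g \<noteq> gF"
  shows "gact q (length w) g (mon w) = scale (\<Prod>l\<leftarrow>w. cartan_weight q g l) (mon w)"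
proof (induction w)
  case Nil
  then show ?case using assms by (simp add: gact.simps)
next
  case (Cons l w)
  have 1: "natural_act q g l = scale (cartan_weight q g l) (mon [l])"
    using assms by (cases g; cases l) (simp_all add: uminus_scale[symmetric])
  have "gact q (Suc (length w)) g (mon [l] * mon w)
      = gact q (Suc 0) g (mon [l]) * gact q (length w) g (mon w)"
    using assms by (cases g) (simp_all add: gact_split tpow_mon)
  then show ?case
    by (simp add: mon_mult gact_one_mon 1 Cons.IH scale_mult_left scale_mult_right mult.commute)
qed


section \<open>Subsets as words\<close>

definition subset_word :: "nat \<Rightarrow> nat set \<Rightarrow> basis list" where
  "subset_word n s = map (\<lambda>i. if i \<in> s then Bx else By) [1..<Suc n]"

text \<open>
  The word basis of \<open>V\<^sup>\<otimes>\<^sup>n\<close> is indexed by subsets of \<open>{1..n}\<close>: this function inverts \<open>subset_word n\<close>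
  (positions are counted from 1, list indices from 0).
\<close>

definition x_positions :: "basis list \<Rightarrow> nat set" where
  "x_positions w = {i \<in> {1..length w}. w ! (i - 1) = Bx}"

lemma uvec_eq_mon: "uvec (Suc n) s = mon (subset_word n s)"
  by (simp add: uvec_def subset_word_def)

lemma length_subset_word [simp]: "length (subset_word n s) = n"
  by (simp add: subset_word_def)

lemma uvec_tpow: "uvec (Suc n) s \<in> tpow n"
  by (simp add: uvec_eq_mon tpow_mon)

lemma x_positions_subset: "length w = n \<Longrightarrow> x_positions w \<subseteq> {1..n}"
  by (auto simp: x_positions_def)

lemma x_positions_subset_word: "s \<subseteq> {1..n} \<Longrightarrow> x_positions (subset_word n s) = s"
  by (force simp: x_positions_def subset_word_def nth_append split: if_splits simp del: upt_Suc)

lemma subset_word_x_positions: "length w = n \<Longrightarrow> subset_word n (x_positions w) = w"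
proof (rule nth_equalityI)
  fix i assume "length w = n" "i < length (subset_word n (x_positions w))"
  then show "subset_word n (x_positions w) ! i = w ! i"
    by (cases "w ! i") (auto simp: subset_word_def x_positions_def simp del: upt_Suc)
qed simp

lemma mon_eq_uvec: "length w = n \<Longrightarrow> mon w = uvec (Suc n) (x_positions w)"
  by (simp add: uvec_eq_mon subset_word_x_positions)

lemma subset_word_inject:
  "s \<subseteq> {1..n} \<Longrightarrow> t \<subseteq> {1..n} \<Longrightarrow> subset_word n s = subset_word n t \<longleftrightarrow> s = t"
  by (metis x_positions_subset_word)

lemma lookup_uvec:
  "s \<subseteq> {1..n} \<Longrightarrow> t \<subseteq> {1..n} \<Longrightarrow>
    Poly_Mapping.lookup (uvec (Suc n) s) (Word (subset_word n t)) = (if s = t then 1 else 0)"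
  by (simp add: uvec_eq_mon mon_def lookup_single when_def subset_word_inject)

lemma tpow_uvec_expand:
  assumes "f \<in> tpow n"
  shows "f = (\<Sum>t\<in>Pow {1..n}. scale (Poly_Mapping.lookup f (Word (subset_word n t))) (uvec (Suc n) t))"
  using assms
proof (induction rule: tpow_induct)
  case (add f g)
  show ?case
    by (subst add.IH(1), subst add.IH(2)) (simp add: lookup_add scale_add_left sum.distrib)
next
  case (scale c f)
  show ?case
    by (subst scale.IH) (simp add: scale_sum)
next
  case (mon w)
  let ?s = "x_positions w"
  have s: "?s \<subseteq> {1..n}" using mon by (rule x_positions_subset)
  have "(\<Sum>t\<in>Pow {1..n}. scale (Poly_Mapping.lookup (uvec (Suc n) ?s) (Word (subset_word n t))) (uvec (Suc n) t))
      = (\<Sum>t\<in>Pow {1..n}. if t = ?s then uvec (Suc n) t else 0)"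
    using s by (intro sum.cong refl) (auto simp: lookup_uvec)
  also have "\<dots> = mon w" using s by (simp add: mon_eq_uvec[OF mon])
  finally show ?case by (simp add: mon_eq_uvec[OF mon])
qed simp

text \<open>
  The eigenvalue of a Cartan generator on \<open>u\<^sub>s\<close> is a function of \<open>m = |s|\<close> alone.  This is why diagrams,
  which preserve the size of a subset, give module endomorphisms.
\<close>

definition subset_weight :: "complex \<Rightarrow> nat \<Rightarrow> gen \<Rightarrow> nat \<Rightarrow> complex" where
  "subset_weight q n g m = cartan_weight q g Bx ^ m * cartan_weight q g By ^ (n - m)"

lemma gact_cartan_uvec:
  assumes "g \<noteq> gE" "g \<noteq> gF" "s \<subseteq> {1..n}"
  shows "gact q n g (uvec (Suc n) s) = scale (subset_weight q n g (card s)) (uvec (Suc n) s)"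
proof -
  have "(\<Prod>l\<leftarrow>subset_word n s. cartan_weight q g l)
      = (\<Prod>i\<in>{1..n}. if i \<in> s then cartan_weight q g Bx else cartan_weight q g By)"
    using prod.distinct_set_conv_list[of "[1..<Suc n]" "\<lambda>i. if i \<in> s then cartan_weight q g Bx else cartan_weight q g By"]
    by (simp add: subset_word_def comp_def if_distrib atLeastLessThanSuc_atLeastAtMost del: upt_Suc)
  also have "\<dots> = cartan_weight q g Bx ^ card ({1..n} \<inter> s) * cartan_weight q g By ^ card ({1..n} \<inter> - s)"
    by (subst prod.If_cases) auto
  also have "{1..n} \<inter> - s = {1..n} - s" by auto
  also have "card \<dots> = n - card s"
    using assms(3) by (simp add: card_Diff_subset finite_subset)
  also have "{1..n} \<inter> s = s" using assms(3) by auto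
  finally show ?thesis
    using gact_cartan_mon[OF assms(1,2), of q "subset_word n s"] by (simp add: uvec_eq_mon subset_weight_def)
qed

section \<open>The rook algebra on subsets\<close>

text \<open>
  The representation of the rook monoid on \<open>V\<^sup>\<otimes>\<^sup>n\<close> by \<open>d u\<^sub>s = u\<^bsub>ds\<^esub>\<close>, which is the partial
  action of \<open>d\<close> on subsets, and its linear extension to the rook algebra.
\<close>

definition diag_op :: "nat \<Rightarrow> (nat \<rightharpoonup> nat) \<Rightarrow> tensor \<Rightarrow> tensor" where
  "diag_op n d = lin_ext (\<lambda>w. let s = x_positions (letters w) in
     if s \<subseteq> dom d then uvec (Suc n) ((the \<circ> d) ` s) else 0)"

definition rook_op :: "nat \<Rightarrow> ((nat \<rightharpoonup> nat) \<Rightarrow>\<^sub>0 complex) \<Rightarrow> tensor \<Rightarrow> tensor" where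
  "rook_op n a u = lin_ext (\<lambda>d. diag_op n d u) a"

lemma linop_diag_op: "linop (diag_op n d)"
  unfolding diag_op_def by (rule linop_lin_ext)

lemma diag_op_uvec:
  "s \<subseteq> {1..n} \<Longrightarrow> diag_op n d (uvec (Suc n) s)
    = (if s \<subseteq> dom d then uvec (Suc n) ((the \<circ> d) ` s) else 0)"
  by (simp add: diag_op_def uvec_eq_mon x_positions_subset_word)

lemma diag_op_tpow: "u \<in> tpow n \<Longrightarrow> diag_op n d u \<in> tpow n"
  unfolding diag_op_def by (rule lin_ext_tpow) (simp add: Let_def uvec_tpow tpow_zero)

lemma linop_rook_op_left: "linop (\<lambda>a. rook_op n a u)"
  unfolding rook_op_def by (rule linop_lin_ext)

lemma linop_rook_op: "linop (rook_op n a)"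
  by (rule linopI)
     (simp_all add: rook_op_def lin_ext_def linop_add[OF linop_diag_op] linop_scale[OF linop_diag_op]
       scale_add sum.distrib scale_sum mult.commute)

lemma rook_op_single [simp]: "rook_op n (Poly_Mapping.single d 1) u = diag_op n d u"
  by (simp add: rook_op_def)

lemma rook_op_tpow: "u \<in> tpow n \<Longrightarrow> rook_op n a u \<in> tpow n"
  unfolding rook_op_def by (rule lin_ext_tpow) (rule diag_op_tpow)

lemma planar_rook_dom: "d \<in> planar_rook n \<Longrightarrow> dom d \<subseteq> {1..n}"
  and planar_rook_image: "d \<in> planar_rook n \<Longrightarrow> s \<subseteq> dom d \<Longrightarrow> (the \<circ> d) ` s \<subseteq> {1..n}"
  and planar_rook_mono: "d \<in> planar_rook n \<Longrightarrow> strict_mono_on (dom d) (the \<circ> d)"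
  by (force simp: planar_rook_def ran_def)+

lemma planar_rook_card_image:
  assumes "d \<in> planar_rook n" "s \<subseteq> dom d"
  shows "card ((the \<circ> d) ` s) = card s"
  using planar_rook_mono[OF assms(1)] assms(2)
  by (intro card_image) (meson inj_on_subset strict_mono_on_imp_inj_on)

lemma planar_rook_comp:
  assumes "d \<in> planar_rook n" "e \<in> planar_rook n"
  shows "d \<circ>\<^sub>m e \<in> planar_rook n"
proof -
  have "dom (d \<circ>\<^sub>m e) \<subseteq> dom e" "ran (d \<circ>\<^sub>m e) \<subseteq> ran d"
    by (auto simp: map_comp_def ran_def split: option.splits)
  moreover have "strict_mono_on (dom (d \<circ>\<^sub>m e)) (the \<circ> (d \<circ>\<^sub>m e))"
  proof (rule strict_mono_onI)
    fix i j assume ij: "i \<in> dom (d \<circ>\<^sub>m e)" "j \<in> dom (d \<circ>\<^sub>m e)" "i < j"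
    then obtain i' j' i'' j'' where eqs: "e i = Some i'" "e j = Some j'" "d i' = Some i''" "d j' = Some j''"
      by (auto simp: map_comp_def split: option.splits)
    then have "i' < j'"
      using strict_mono_onD[OF planar_rook_mono[OF assms(2)], of i j] ij(3) by auto
    then have "i'' < j''"
      using strict_mono_onD[OF planar_rook_mono[OF assms(1)], of i' j'] eqs by auto
    then show "(the \<circ> (d \<circ>\<^sub>m e)) i < (the \<circ> (d \<circ>\<^sub>m e)) j" using eqs by simp
  qed
  ultimately show ?thesis using assms unfolding planar_rook_def by blast
qed

text \<open>
  Both sides kill \<open>u\<^sub>s\<close> unless \<open>e\<close> is defined on \<open>s\<close> and \<open>d\<close> on the image \<open>es\<close>, which is the condition for
  the composite to be defined on \<open>s\<close>.
\<close>

lemma diag_op_comp: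
  assumes "d \<in> planar_rook n" "e \<in> planar_rook n" "u \<in> tpow n"
  shows "diag_op n (d \<circ>\<^sub>m e) u = diag_op n d (diag_op n e u)"
proof (rule linop_eq_tpow[OF linop_diag_op linop_comp[OF linop_diag_op linop_diag_op] assms(3)])
  fix w :: "basis list" assume w: "length w = n"
  define s where "s = x_positions w"
  have s: "s \<subseteq> {1..n}" using w unfolding s_def by (rule x_positions_subset)
  have dom: "s \<subseteq> dom (d \<circ>\<^sub>m e) \<longleftrightarrow> s \<subseteq> dom e \<and> (the \<circ> e) ` s \<subseteq> dom d"
    by (fastforce simp: map_comp_def split: option.splits)
  have img: "(the \<circ> (d \<circ>\<^sub>m e)) ` s = (the \<circ> d) ` (the \<circ> e) ` s" if "s \<subseteq> dom e"
    using that by (force simp: image_image map_comp_def intro!: image_cong split: option.splits)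
  show "diag_op n (d \<circ>\<^sub>m e) (mon w) = diag_op n d (diag_op n e (mon w))"
  proof (cases "s \<subseteq> dom e")
    case True
    show ?thesis
      unfolding mon_eq_uvec[OF w] s_def[symmetric] diag_op_uvec[OF s] dom img[OF True]
      using True diag_op_uvec[OF planar_rook_image[OF assms(2) True], of d] by simp
  next
    case False
    then show ?thesis
      unfolding mon_eq_uvec[OF w] s_def[symmetric] diag_op_uvec[OF s] dom
      by (simp add: linop_zero[OF linop_diag_op])
  qed
qed

lemma rook_op_mult:
  assumes "a \<in> carrier (rook_alg n)" "b \<in> carrier (rook_alg n)" "u \<in> tpow n"
  shows "rook_op n (a \<otimes>\<^bsub>rook_alg n\<^esub> b) u = rook_op n a (rook_op n b u)"
proof -
  let ?la = "Poly_Mapping.lookup a" and ?lb = "Poly_Mapping.lookup b"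
  note L = linop_sum[OF linop_rook_op_left] linop_scale[OF linop_rook_op_left]
  have single: "Poly_Mapping.single d c = scale c (Poly_Mapping.single d 1)"
    for d and c :: complex
    by (simp add: scale_single)
  have "rook_op n (a \<otimes>\<^bsub>rook_alg n\<^esub> b) u
      = (\<Sum>d\<in>Poly_Mapping.keys a. \<Sum>e\<in>Poly_Mapping.keys b. scale (?la d * ?lb e) (diag_op n (d \<circ>\<^sub>m e) u))"
    by (simp add: rook_alg_def L) (subst single, simp add: L)
  also have "\<dots> = (\<Sum>d\<in>Poly_Mapping.keys a. \<Sum>e\<in>Poly_Mapping.keys b.
      scale (?la d * ?lb e) (diag_op n d (diag_op n e u)))"
    using assms by (intro sum.cong refl) (auto simp: rook_alg_def diag_op_comp subset_iff)
  also have "\<dots> = rook_op n a (rook_op n b u)"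
    by (simp add: rook_op_def lin_ext_def linop_sum[OF linop_diag_op] linop_scale[OF linop_diag_op] scale_sum)
  finally show ?thesis .
qed

lemma rook_op_one: "u \<in> tpow n \<Longrightarrow> rook_op n \<one>\<^bsub>rook_alg n\<^esub> u = u"
proof -
  have "diag_op n (Some |` {1..n}) (mon w) = mon w" if "length w = n" for w
  proof -
    have "(the \<circ> (Some |` {1..n})) ` x_positions w = x_positions w"
      using x_positions_subset[OF that] by (force simp: restrict_map_def)
    then show ?thesis
      using x_positions_subset[OF that] by (simp add: mon_eq_uvec[OF that] diag_op_uvec)
  qed
  then show "rook_op n \<one>\<^bsub>rook_alg n\<^esub> u = u" if "u \<in> tpow n"
    using linop_eq_tpow[OF linop_diag_op linop_id that] by (simp add: rook_alg_def)
qed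

text \<open>
  At the least point where \<open>f\<close> and \<open>g\<close> differ, the smaller of the two values would have to be taken by
  the other function at an earlier point, where the functions agree; this contradicts injectivity.
\<close>

lemma strict_mono_on_unique:
  fixes f g :: "nat \<Rightarrow> nat"
  assumes "strict_mono_on s f" "strict_mono_on s g" "f ` s = g ` s" "i \<in> s"
  shows "f i = g i"
  using assms(4)
proof (induction i rule: less_induct)
  case (less i)
  have False if F: "strict_mono_on s f" "strict_mono_on s g" "f i \<in> g ` s" "f i < g i"
      "\<And>j. j < i \<Longrightarrow> j \<in> s \<Longrightarrow> f j = g j" for f g :: "nat \<Rightarrow> nat"
  proof -
    obtain j where j: "j \<in> s" "f i = g j" using F(3) by auto
    then have "j < i"
      using F(2,4) less.prems by (metis linorder_neqE_nat less_asym strict_mono_onD)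
    then have "f j = f i" using F(5) j by simp
    then show False using \<open>j < i\<close> F(1) j(1) less.prems by (metis less_irrefl strict_mono_onD)
  qed
  from this[of f g] this[of g f] show ?case
    using assms less by (metis imageI linorder_neqE_nat)
qed

lemma planar_rook_eqI:
  assumes "d \<in> planar_rook n" "e \<in> planar_rook n" "dom d = dom e"
    "(the \<circ> d) ` dom d = (the \<circ> e) ` dom d"
  shows "d = e"
proof
  fix i
  show "d i = e i"
  proof (cases "i \<in> dom d")
    case True
    have "(the \<circ> d) i = (the \<circ> e) i"
      using planar_rook_mono[OF assms(1)] planar_rook_mono[OF assms(2), folded assms(3)] assms(4) True
      by (rule strict_mono_on_unique)
    moreover obtain x y where "d i = Some x" "e i = Some y"
      using True assms(3) by blast
    ultimately show ?thesis by simp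
  qed (use assms(3) in \<open>metis domIff\<close>)
qed

text \<open>
  Compose the increasing enumeration of \<open>t\<close> with the inverse of that of \<open>s\<close>.
\<close>

lemma planar_rook_exists:
  assumes "s \<subseteq> {1..n}" "t \<subseteq> {1..n}" "card s = card t"
  obtains d where "d \<in> planar_rook n" "dom d = s" "(the \<circ> d) ` s = t"
proof -
  have fin: "finite s" "finite t" using assms finite_subset by auto
  obtain f where f: "bij_betw f {..<card s} s" "strict_mono_on {..<card s} f"
    using ex_bij_betw_strict_mono_card[OF fin(1)] .
  obtain g where g: "bij_betw g {..<card s} t" "strict_mono_on {..<card s} g"
    using ex_bij_betw_strict_mono_card[OF fin(2)] assms(3) by metis
  define h where "h = g \<circ> inv_into {..<card s} f"
  define d where "d = (\<lambda>i. Some (h i)) |` s"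
  have bij: "bij_betw h s t"
    unfolding h_def using bij_betw_inv_into[OF f(1)] g(1) by (rule bij_betw_trans)
  have img: "(the \<circ> d) ` s = t"
    using bij by (auto simp: d_def bij_betw_def)
  have "strict_mono_on s h"
  proof (rule strict_mono_onI)
    fix i j assume "i \<in> s" "j \<in> s" "i < j"
    then obtain a b where ab: "a \<in> {..<card s}" "b \<in> {..<card s}" "i = f a" "j = f b"
      using bij_betw_imp_surj_on[OF f(1)] by (metis imageE)
    with \<open>i < j\<close> have "a < b"
      using f(2) by (metis linorder_neqE_nat less_asym less_irrefl strict_mono_onD)
    moreover have "inv_into {..<card s} f i = a" "inv_into {..<card s} f j = b"
      using f(1) ab by (simp_all add: bij_betw_def)
    ultimately show "h i < h j" using g(2) ab by (simp add: h_def strict_mono_onD)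
  qed
  then have "strict_mono_on (dom d) (the \<circ> d)"
    by (auto simp: d_def strict_mono_on_def)
  moreover have "dom d = s" by (auto simp: d_def)
  moreover have "ran d \<subseteq> t" using bij by (auto simp: d_def ran_def restrict_map_def bij_betw_def split: if_splits)
  ultimately show thesis
    using that[of d] img assms by (auto simp: planar_rook_def)
qed

text \<open>
  Among the diagrams in the support of \<open>a\<close> take \<open>d\<close> with the largest domain \<open>s\<close>.  Another diagram
  contributes to the matrix entry from \<open>s\<close> to \<open>ds\<close> only if its domain contains \<open>s\<close>, hence equals
  \<open>s\<close> by maximality, and if it has the same range; then it is \<open>d\<close>.  So that entry is the coefficient of \<open>d\<close>.
\<close>

lemma rook_op_faithful:
  assumes a: "a \<in> carrier (rook_alg n)" and zero: "\<And>u. u \<in> tpow n \<Longrightarrow> rook_op n a u = 0"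
  shows "a = 0"
proof (rule ccontr)
  assume "a \<noteq> 0"
  then have K: "finite (Poly_Mapping.keys a)" "Poly_Mapping.keys a \<noteq> {}" by simp_all
  have planar: "e \<in> planar_rook n" if "e \<in> Poly_Mapping.keys a" for e
    using a that by (auto simp: rook_alg_def)
  obtain d where d: "d \<in> Poly_Mapping.keys a"
    and max: "\<And>e. e \<in> Poly_Mapping.keys a \<Longrightarrow> card (dom e) \<le> card (dom d)"
    using obtains_MAX[OF K, of "\<lambda>d. card (dom d)"] Max_ge K(1)
    by (metis (no_types, lifting) finite_imageI imageI)
  define s where "s = dom d"
  define t where "t = (the \<circ> d) ` s"
  have s: "s \<subseteq> {1..n}" and t: "t \<subseteq> {1..n}"
    using planar_rook_dom planar_rook_image planar d by (auto simp: s_def t_def)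
  have entry: "Poly_Mapping.lookup (diag_op n e (uvec (Suc n) s)) (Word (subset_word n t))
      = (if e = d then 1 else 0)" if e: "e \<in> Poly_Mapping.keys a" for e
  proof -
    have eq: "e = d" if "s \<subseteq> dom e" "(the \<circ> e) ` s = t"
    proof (rule planar_rook_eqI[OF planar[OF e] planar[OF d]])
      have "finite (dom e)" using planar_rook_dom[OF planar[OF e]] finite_subset by auto
      then show eq: "dom e = dom d"
        using card_seteq[of "dom e" s] that(1) max[OF e] by (simp add: s_def)
      show "(the \<circ> e) ` dom e = (the \<circ> d) ` dom e"
        using that(2) by (simp add: eq t_def s_def)
    qed
    show ?thesis
    proof (cases "s \<subseteq> dom e")
      case True
      have "(the \<circ> e) ` s = t \<longleftrightarrow> e = d" using eq[OF True] by (auto simp: t_def)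
      with True show ?thesis
        unfolding diag_op_uvec[OF s] by (simp only: if_True lookup_uvec planar_rook_image[OF planar[OF e] True] t)
    next
      case False
      then show ?thesis unfolding diag_op_uvec[OF s] by (auto simp: s_def)
    qed
  qed
  have "0 = Poly_Mapping.lookup (rook_op n a (uvec (Suc n) s)) (Word (subset_word n t))"
    by (simp add: zero uvec_tpow)
  also have "\<dots> = (\<Sum>e\<in>Poly_Mapping.keys a. if e = d then Poly_Mapping.lookup a e else 0)"
    unfolding rook_op_def lin_ext_def lookup_sum lookup_scale by (intro sum.cong refl) (simp add: entry)
  also have "\<dots> = Poly_Mapping.lookup a d" by (simp add: d)
  finally show False using d by (simp add: in_keys_iff)
qed

lemma rook_alg_add: "a \<in> carrier (rook_alg n) \<Longrightarrow> b \<in> carrier (rook_alg n) \<Longrightarrow> a + b \<in> carrier (rook_alg n)"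
  and rook_alg_scale: "a \<in> carrier (rook_alg n) \<Longrightarrow> scale c a \<in> carrier (rook_alg n)"
  and rook_alg_diff: "a \<in> carrier (rook_alg n) \<Longrightarrow> b \<in> carrier (rook_alg n) \<Longrightarrow> a - b \<in> carrier (rook_alg n)"
  and rook_alg_single: "d \<in> planar_rook n \<Longrightarrow> Poly_Mapping.single d 1 \<in> carrier (rook_alg n)"
  and rook_alg_zero: "0 \<in> carrier (rook_alg n)"
  using keys_add[of a b] keys_diff[of a b] by (auto simp: rook_alg_def in_keys_iff)

lemma rook_alg_sum: "(\<And>i. i \<in> I \<Longrightarrow> a i \<in> carrier (rook_alg n)) \<Longrightarrow> (\<Sum>i\<in>I. a i) \<in> carrier (rook_alg n)"
  by (induction I rule: infinite_finite_induct) (simp_all add: rook_alg_add rook_alg_zero)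

lemma rook_alg_closed:
  assumes "a \<in> carrier (rook_alg n)" "b \<in> carrier (rook_alg n)"
  shows "a \<otimes>\<^bsub>rook_alg n\<^esub> b \<in> carrier (rook_alg n)"
proof -
  have "(\<Sum>d\<in>Poly_Mapping.keys a. \<Sum>e\<in>Poly_Mapping.keys b.
      Poly_Mapping.single (d \<circ>\<^sub>m e) (Poly_Mapping.lookup a d * Poly_Mapping.lookup b e)) \<in> carrier (rook_alg n)"
    using assms by (intro rook_alg_sum) (auto simp: rook_alg_def planar_rook_comp subset_iff)
  then show ?thesis by (simp add: rook_alg_def)
qed

lemma rook_alg_one: "\<one>\<^bsub>rook_alg n\<^esub> \<in> carrier (rook_alg n)"
  by (auto simp: rook_alg_def planar_rook_def ran_def restrict_map_def strict_mono_on_def split: if_splits)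

text \<open>
  The diagram \<open>d\<close> from \<open>s\<close> to \<open>t\<close> acts as the sum of the matrix units from \<open>s'\<close> to \<open>ds'\<close> over all
  \<open>s' \<subseteq> s\<close>.  Those with \<open>s' \<noteq> s\<close> are available by induction on the size, and subtracting them
  leaves the matrix unit from \<open>s\<close> to \<open>t\<close>.
\<close>

lemma rook_matrix_unit:
  assumes "s \<subseteq> {1..n}" "t \<subseteq> {1..n}" "card s = card t"
  shows "\<exists>a\<in>carrier (rook_alg n). \<forall>r\<subseteq>{1..n}.
    rook_op n a (uvec (Suc n) r) = (if r = s then uvec (Suc n) t else 0)"
  using assms
proof (induction "card s" arbitrary: s t rule: less_induct)
  case less
  obtain d where d: "d \<in> planar_rook n" "dom d = s" "(the \<circ> d) ` s = t"
    using planar_rook_exists[OF less.prems] .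
  have fin: "finite s" using less.prems(1) finite_subset by auto
  have fins: "finite {s'. s' \<subset> s}" by (rule finite_subset[of _ "Pow s"]) (use fin in auto)
  have "\<exists>a. a \<in> carrier (rook_alg n) \<and> (\<forall>r\<subseteq>{1..n}.
    rook_op n a (uvec (Suc n) r) = (if r = s' then uvec (Suc n) ((the \<circ> d) ` s') else 0))"
    if s': "s' \<subset> s" for s'
  proof -
    have "s' \<subseteq> dom d" using s' d(2) by auto
    then have "(the \<circ> d) ` s' \<subseteq> {1..n}" "card s' = card ((the \<circ> d) ` s')"
      using planar_rook_image[OF d(1)] planar_rook_card_image[OF d(1)] by auto
    moreover have "s' \<subseteq> {1..n}" using s' less.prems(1) by auto
    ultimately show ?thesis
      using less.hyps[OF psubset_card_mono[OF fin s']] by blast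
  qed
  then obtain A where A: "\<And>s'. s' \<subset> s \<Longrightarrow> A s' \<in> carrier (rook_alg n)"
    and A_act: "\<And>s' r. s' \<subset> s \<Longrightarrow> r \<subseteq> {1..n} \<Longrightarrow>
      rook_op n (A s') (uvec (Suc n) r) = (if r = s' then uvec (Suc n) ((the \<circ> d) ` s') else 0)"
    by metis
  define a where "a = Poly_Mapping.single d 1 - (\<Sum>s'\<in>{s'. s' \<subset> s}. A s')"
  have "a \<in> carrier (rook_alg n)"
    unfolding a_def by (intro rook_alg_diff rook_alg_single rook_alg_sum d(1)) (simp add: A)
  moreover have "rook_op n a (uvec (Suc n) r) = (if r = s then uvec (Suc n) t else 0)"
    if r: "r \<subseteq> {1..n}" for r
  proof -
    have "(\<Sum>s'\<in>{s'. s' \<subset> s}. rook_op n (A s') (uvec (Suc n) r))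
        = (\<Sum>s'\<in>{s'. s' \<subset> s}. if r = s' then uvec (Suc n) ((the \<circ> d) ` s') else 0)"
      by (intro sum.cong refl A_act[OF _ r]) simp
    also have "\<dots> = (if r \<subset> s then uvec (Suc n) ((the \<circ> d) ` r) else 0)"
      unfolding sum.delta'[OF fins] by simp
    finally have "rook_op n a (uvec (Suc n) r) = (if r \<subseteq> s then uvec (Suc n) ((the \<circ> d) ` r) else 0)
        - (if r \<subset> s then uvec (Suc n) ((the \<circ> d) ` r) else 0)"
      unfolding a_def linop_diff[OF linop_rook_op_left] linop_sum[OF linop_rook_op_left]
        rook_op_single diag_op_uvec[OF r] d(2) by (rule arg_cong)
    then show ?thesis
      by (cases "r = s"; cases "r \<subseteq> s") (simp_all only: d(3) psubset_eq simp_thms if_True if_False diff_self diff_zero)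
  qed
  ultimately show ?case by blast
qed

text \<open>
  The hypothesis on matrix entries says that \<open>\<Phi>\<close> is block diagonal with respect to \<open>|s|\<close>, so it is
  a combination of the matrix units just found.
\<close>

lemma rook_op_surj:
  assumes "linop \<Phi>" and "\<And>u. u \<in> tpow n \<Longrightarrow> \<Phi> u \<in> tpow n"
    and "\<And>s t. s \<subseteq> {1..n} \<Longrightarrow> t \<subseteq> {1..n} \<Longrightarrow> card s \<noteq> card t \<Longrightarrow>
      Poly_Mapping.lookup (\<Phi> (uvec (Suc n) s)) (Word (subset_word n t)) = 0"
  obtains a where "a \<in> carrier (rook_alg n)" "\<And>u. u \<in> tpow n \<Longrightarrow> rook_op n a u = \<Phi> u"
proof -
  define I where "I = {(s, t). s \<subseteq> {1..n} \<and> t \<subseteq> {1..n} \<and> card s = card t}"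
  define m where "m s t = Poly_Mapping.lookup (\<Phi> (uvec (Suc n) s)) (Word (subset_word n t))" for s t
  have "\<forall>p\<in>I. \<exists>a\<in>carrier (rook_alg n). \<forall>r\<subseteq>{1..n}.
      rook_op n a (uvec (Suc n) r) = (if r = fst p then uvec (Suc n) (snd p) else 0)"
  proof
    fix p assume "p \<in> I"
    then have "fst p \<subseteq> {1..n}" "snd p \<subseteq> {1..n}" "card (fst p) = card (snd p)" by (auto simp: I_def)
    then show "\<exists>a\<in>carrier (rook_alg n). \<forall>r\<subseteq>{1..n}.
      rook_op n a (uvec (Suc n) r) = (if r = fst p then uvec (Suc n) (snd p) else 0)"
      by (rule rook_matrix_unit)
  qed
  then obtain U where U: "\<And>p. p \<in> I \<Longrightarrow> U p \<in> carrier (rook_alg n)"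
    and U_act: "\<And>p r. p \<in> I \<Longrightarrow> r \<subseteq> {1..n} \<Longrightarrow>
      rook_op n (U p) (uvec (Suc n) r) = (if r = fst p then uvec (Suc n) (snd p) else 0)"
    by metis
  define a where "a = (\<Sum>p\<in>I. scale (m (fst p) (snd p)) (U p))"
  have "finite I" by (rule finite_subset[of _ "Pow {1..n} \<times> Pow {1..n}"]) (auto simp: I_def)
  have act: "rook_op n a (uvec (Suc n) r) = \<Phi> (uvec (Suc n) r)" if r: "r \<subseteq> {1..n}" for r
  proof -
    have "rook_op n a (uvec (Suc n) r)
        = (\<Sum>p\<in>I. if fst p = r then scale (m r (snd p)) (uvec (Suc n) (snd p)) else 0)"
      unfolding a_def linop_sum[OF linop_rook_op_left] linop_scale[OF linop_rook_op_left]
      by (intro sum.cong refl) (auto simp: U_act[OF _ r])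
    also have "\<dots> = (\<Sum>p\<in>{r} \<times> {t. t \<subseteq> {1..n} \<and> card r = card t}. scale (m r (snd p)) (uvec (Suc n) (snd p)))"
      using r by (intro sum.mono_neutral_cong_right \<open>finite I\<close>) (auto simp: I_def)
    also have "\<dots> = (\<Sum>t\<in>{t. t \<subseteq> {1..n} \<and> card r = card t}. scale (m r t) (uvec (Suc n) t))"
      by (rule sum.reindex_bij_witness[of _ "\<lambda>t. (r, t)" snd]) auto
    also have "\<dots> = (\<Sum>t\<in>Pow {1..n}. scale (m r t) (uvec (Suc n) t))"
      using r by (intro sum.mono_neutral_left) (auto simp: m_def assms(3))
    also have "\<dots> = \<Phi> (uvec (Suc n) r)"
      unfolding m_def by (rule tpow_uvec_expand[symmetric]) (intro assms(2) uvec_tpow)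
    finally show ?thesis .
  qed
  show thesis
  proof (rule that)
    show "a \<in> carrier (rook_alg n)"
      unfolding a_def by (intro rook_alg_sum rook_alg_scale U)
    show "rook_op n a u = \<Phi> u" if "u \<in> tpow n" for u
      using that by (rule linop_eq_tpow[OF linop_rook_op assms(1)])
        (simp add: mon_eq_uvec act[OF x_positions_subset])
  qed
qed

section \<open>The module as two copies of a smaller tensor power\<close>

locale generic_gl11 =
  fixes q :: complex and n :: nat
  assumes q_nonzero: "q \<noteq> 0" and q_generic: "\<And>m::nat. m \<ge> 1 \<Longrightarrow> q ^ m \<noteq> 1"
begin

abbreviation Ek :: "tensor \<Rightarrow> tensor" where "Ek \<equiv> gact q (Suc n) gE"
abbreviation Fk :: "tensor \<Rightarrow> tensor" where "Fk \<equiv> gact q (Suc n) gF"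

text \<open>
  The embedding of \<open>V\<^sup>\<otimes>\<^sup>n\<close> into \<open>V\<^sup>\<otimes>\<^sup>n\<^sup>+\<^sup>1\<close> with \<open>v\<^sub>s = raise u\<^sub>s\<close>.  The map \<open>x_part\<close> reads off the component in
  \<open>x \<otimes> V\<^sup>\<otimes>\<^sup>n\<close>; the factor \<open>q\<^sup>n\<close> cancels the coefficient \<open>q\<^sup>-\<^sup>n\<close> of that component in \<open>raise u\<close>.
\<close>

definition raise :: "tensor \<Rightarrow> tensor" where
  "raise u = Ek (mon [By] * u)"

definition x_part :: "tensor \<Rightarrow> tensor" where
  "x_part = lin_ext (\<lambda>w. case letters w of Bx # v \<Rightarrow> scale (q ^ n) (mon v) | _ \<Rightarrow> 0)"

text \<open>
  The quantum integer \<open>[n + 1]\<close>, the scalar by which \<open>EF + FE\<close> acts.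
\<close>

definition quantum_dim :: complex where
  "quantum_dim = (q ^ Suc n - inverse q ^ Suc n) / (q - inverse q)"

lemma q_neq_inverse: "q \<noteq> inverse q"
proof
  assume "q = inverse q"
  then have "q ^ 2 = 1" using q_nonzero by (metis power2_eq_square right_inverse)
  then show False using q_generic[of 2] by simp
qed

lemma quantum_dim_nonzero: "quantum_dim \<noteq> 0"
proof
  assume "quantum_dim = 0"
  then have "q ^ Suc n = inverse q ^ Suc n" using q_neq_inverse by (simp add: quantum_dim_def)
  then have "q ^ Suc n * q ^ Suc n = 1"
    using q_nonzero by (metis power_inverse power_not_zero right_inverse)
  then show False using q_generic[of "Suc n + Suc n"] unfolding power_add by simp
qed

lemmas module_rels = uq_moduleD[OF uq_module_gact[OF q_nonzero q_neq_inverse]]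

lemmas Ek_lin = linop_add[OF linop_gact] linop_scale[OF linop_gact] linop_zero[OF linop_gact]
  linop_diff[OF linop_gact] linop_uminus[OF linop_gact]

lemma gK_act: "f \<in> tpow m \<Longrightarrow> gact q m gK f = scale (q ^ m) f"
proof (rule linop_eq_tpow[OF linop_gact linop_cmul[OF linop_id]])
  fix w :: "basis list" assume w: "length w = m"
  have "cartan_weight q gK l = q" for l
    by (cases l) (simp_all add: gK_def pairing_def h1_def h2_def eps1_def eps2_def)
  then have "(\<Prod>l\<leftarrow>w. cartan_weight q gK l) = q ^ m"
    using w by (simp add: map_replicate_const prod_list_replicate)
  then show "gact q m gK (mon w) = scale (q ^ m) (mon w)"
    using gact_cartan_mon[of gK q w] w by (simp add: gK_def)
qed

lemma linop_raise: "linop raise"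
  unfolding raise_def by (intro linop_comp[OF linop_gact] linop_mult_right)

lemma linop_x_part: "linop x_part"
  unfolding x_part_def by (rule linop_lin_ext)

lemmas lin = linop_add[OF linop_raise] linop_scale[OF linop_raise] linop_zero[OF linop_raise]
  linop_diff[OF linop_raise] linop_add[OF linop_x_part] linop_scale[OF linop_x_part]
  linop_zero[OF linop_x_part] linop_diff[OF linop_x_part] Ek_lin

lemma letter_mult_tpow: "u \<in> tpow n \<Longrightarrow> mon [l] * u \<in> tpow (Suc n)"
  using tpow_mult[of "mon [l]" "Suc 0" u n] by (simp add: tpow_mon)

lemma raise_tpow: "u \<in> tpow n \<Longrightarrow> raise u \<in> tpow (Suc n)"
  unfolding raise_def by (intro gact_tpow letter_mult_tpow)

lemma x_part_tpow: "f \<in> tpow (Suc n) \<Longrightarrow> x_part f \<in> tpow n"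
  unfolding x_part_def
  by (rule lin_ext_tpow)
     (auto simp: tpow_def[of "Suc n"] tpow_zero tpow_scale tpow_mon split: list.split basis.split)

lemma raise_eq:
  "u \<in> tpow n \<Longrightarrow> raise u = scale (inverse q ^ n) (mon [Bx] * u) - mon [By] * gact q n gE u"
  using gKinv_act[OF q_nonzero, of u n]
  by (simp add: raise_def gact_split tpow_mon gact_one_mon scale_mult_right power_int_minus power_inverse)

lemma x_part_x: "u \<in> tpow n \<Longrightarrow> x_part (mon [Bx] * u) = scale (q ^ n) u"
  and x_part_y: "u \<in> tpow n \<Longrightarrow> x_part (mon [By] * u) = 0"
  by (erule linop_eq_tpow[rotated 2];
      simp add: mon_mult x_part_def linop_cmul linop_id linop_const_zero
        linop_comp[OF linop_lin_ext linop_mult_right])+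

lemma x_part_raise: "u \<in> tpow n \<Longrightarrow> x_part (raise u) = u"
  using q_nonzero
  by (simp add: raise_eq lin x_part_x x_part_y gact_tpow power_mult_distrib[symmetric])

text \<open>
  By linearity \<open>f\<close> may be taken to be a word.  If it starts with \<open>y\<close>, so \<open>f = y \<otimes> v\<close>, this is \<open>x_part_raise\<close>.  For
  \<open>f = x \<otimes> v\<close>, both \<open>E f\<close> and \<open>raise (E v)\<close> are multiples of \<open>x \<otimes> E v\<close>, since \<open>E\<^sup>2 = 0\<close>.
\<close>

lemma raise_x_part:
  assumes "f \<in> tpow (Suc n)"
  shows "raise (x_part (Ek f)) = Ek f"
  using assms
proof (rule linop_eq_tpow[rotated 2])
  fix w :: "basis list" assume "length w = Suc n"
  then obtain l v where w: "w = l # v" "length v = n" by (auto simp: length_Suc_conv)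
  have v: "mon v \<in> tpow n" using w by (simp add: tpow_mon)
  show "raise (x_part (Ek (mon w))) = Ek (mon w)"
  proof (cases l)
    case By
    then have "Ek (mon w) = raise (mon v)" by (simp add: raise_def w mon_mult)
    then show ?thesis by (simp add: x_part_raise v)
  next
    case Bx
    have "Ek (mon [Bx] * mon v) = mon [Bx] * gact q n gE (mon v)"
      using v by (simp add: gact_split tpow_mon gact_one_mon)
    then have *: "Ek (mon w) = mon [Bx] * gact q n gE (mon v)"
      by (simp add: w Bx mon_mult)
    have "raise (gact q n gE (mon v)) = scale (inverse q ^ n) (Ek (mon w))"
      by (simp add: raise_eq gact_tpow v module_rels *)
    then show ?thesis
      using q_nonzero by (simp add: * x_part_x gact_tpow v lin power_mult_distrib[symmetric])
  qed
qed (intro linop_comp[OF linop_raise] linop_comp[OF linop_x_part] linop_gact)+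

lemma Ek_raise: "u \<in> tpow n \<Longrightarrow> Ek (raise u) = 0"
  by (simp add: raise_def module_rels letter_mult_tpow)

lemma Ek_Fk_add: "f \<in> tpow (Suc n) \<Longrightarrow> Ek (Fk f) + Fk (Ek f) = scale quantum_dim f"
  using gKinv_act[OF q_nonzero, of f "Suc n"]
  by (simp add: module_rels gK_act scale_diff_left[symmetric] quantum_dim_def power_int_minus
      power_inverse del: power_Suc of_nat_Suc)

lemma Ek_Fk_raise: "u \<in> tpow n \<Longrightarrow> Ek (Fk (raise u)) = scale quantum_dim (raise u)"
  using Ek_Fk_add[OF raise_tpow] by (simp add: Ek_raise lin)

lemma Fk_Fk: "f \<in> tpow (Suc n) \<Longrightarrow> Fk (Fk f) = 0"
  by (simp add: module_rels)

text \<open>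
  The coordinates of \<open>f\<close> in the decomposition into the image of \<open>raise\<close> and its image under \<open>F\<close>.  They come
  from \<open>f = [n + 1]\<^sup>-\<^sup>1 (E F f + F E f)\<close>, both \<open>E F f\<close> and \<open>E f\<close> being in the image of \<open>E\<close>.
\<close>

definition top_part :: "tensor \<Rightarrow> tensor" where
  "top_part f = scale (inverse quantum_dim) (x_part (Ek (Fk f)))"

definition bottom_part :: "tensor \<Rightarrow> tensor" where
  "bottom_part f = scale (inverse quantum_dim) (x_part (Ek f))"

lemma linop_top_part: "linop top_part" and linop_bottom_part: "linop bottom_part"
  unfolding top_part_def bottom_part_def
  by (intro linop_cmul linop_comp[OF linop_x_part] linop_comp[OF linop_gact] linop_gact)+

lemma parts_tpow:
  "f \<in> tpow (Suc n) \<Longrightarrow> top_part f \<in> tpow n" "f \<in> tpow (Suc n) \<Longrightarrow> bottom_part f \<in> tpow n"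
  by (simp_all add: top_part_def bottom_part_def tpow_scale x_part_tpow gact_tpow)

lemma parts_raise:
  "u \<in> tpow n \<Longrightarrow> top_part (raise u) = u" "u \<in> tpow n \<Longrightarrow> bottom_part (raise u) = 0"
  by (simp_all add: top_part_def bottom_part_def Ek_Fk_raise Ek_raise x_part_raise lin quantum_dim_nonzero)

lemma parts_Fk_raise:
  "u \<in> tpow n \<Longrightarrow> top_part (Fk (raise u)) = 0" "u \<in> tpow n \<Longrightarrow> bottom_part (Fk (raise u)) = u"
  by (simp_all add: top_part_def bottom_part_def Ek_Fk_raise Fk_Fk raise_tpow x_part_raise lin quantum_dim_nonzero)

lemma raise_decomposition:
  assumes "f \<in> tpow (Suc n)"
  shows "f = raise (top_part f) + Fk (raise (bottom_part f))"
proof -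
  have "raise (top_part f) + Fk (raise (bottom_part f))
      = scale (inverse quantum_dim) (Ek (Fk f) + Fk (Ek f))"
    by (simp add: top_part_def bottom_part_def lin raise_x_part gact_tpow assms scale_add)
  then show ?thesis by (simp add: Ek_Fk_add assms quantum_dim_nonzero)
qed

lemma EndC_eq_on_raise:
  assumes "\<phi> \<in> carrier (EndC (Suc n))" "\<psi> \<in> carrier (EndC (Suc n))"
    and "\<And>u. u \<in> tpow n \<Longrightarrow> \<phi> (raise u) = \<psi> (raise u)"
    and "\<And>u. u \<in> tpow n \<Longrightarrow> \<phi> (Fk (raise u)) = \<psi> (Fk (raise u))"
  shows "\<phi> = \<psi>"
proof (rule EndC_eqI[OF assms(1,2)])
  fix f assume f: "f \<in> tpow (Suc n)"
  note t = raise_tpow[OF parts_tpow(1)[OF f]] gact_tpow[OF raise_tpow[OF parts_tpow(2)[OF f]]]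
  have "\<phi> (raise (top_part f) + Fk (raise (bottom_part f)))
      = \<psi> (raise (top_part f) + Fk (raise (bottom_part f)))"
    unfolding EndC_add[OF assms(1) t] EndC_add[OF assms(2) t]
    by (simp add: assms(3,4) parts_tpow f)
  then show "\<phi> f = \<psi> f" using raise_decomposition[OF f] by simp
qed

text \<open>
  An operator on \<open>V\<^sup>\<otimes>\<^sup>n\<close>, applied to both copies at once.
\<close>

definition inflate :: "(tensor \<Rightarrow> tensor) \<Rightarrow> tensor \<Rightarrow> tensor" where
  "inflate \<Phi> = (\<lambda>f\<in>tpow (Suc n). raise (\<Phi> (top_part f)) + Fk (raise (\<Phi> (bottom_part f))))"

lemma inflate_EndC:
  assumes "linop \<Phi>" "\<And>u. u \<in> tpow n \<Longrightarrow> \<Phi> u \<in> tpow n"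
  shows "inflate \<Phi> \<in> carrier (EndC (Suc n))"
  unfolding inflate_def
  by (rule EndC_restrict)
     (intro linop_plus linop_comp[OF linop_raise] linop_comp[OF linop_gact] linop_comp[OF assms(1)]
        linop_top_part linop_bottom_part tpow_add gact_tpow raise_tpow assms(2) parts_tpow | assumption)+

lemma inflate_raise:
  assumes "linop \<Phi>" "u \<in> tpow n"
  shows "inflate \<Phi> (raise u) = raise (\<Phi> u)" "inflate \<Phi> (Fk (raise u)) = Fk (raise (\<Phi> u))"
  using assms(2)
  by (simp_all add: inflate_def raise_tpow gact_tpow parts_raise parts_Fk_raise linop_zero[OF assms(1)] lin)

section \<open>The action of the rook algebra\<close>

lemma vvec_eq_raise: "vvec q (Suc n) s = raise (uvec (Suc n) s)"
  by (simp add: vvec_def raise_def)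

lemma vvec_diag_eq_raise:
  "s \<subseteq> {1..n} \<Longrightarrow> vvec_diag q (Suc n) d s = raise (diag_op n d (uvec (Suc n) s))"
  by (simp add: vvec_diag_def diag_op_uvec vvec_eq_raise lin)

text \<open>
  The formulas prescribed for diagrams and for the vectors \<open>v\<^sub>s\<close>, \<open>F v\<^sub>s\<close> extend bilinearly.  From here on a
  rook action is only used through this description.
\<close>

lemma rook_action_raise:
  assumes "rook_action q (Suc n) \<rho>" "a \<in> carrier (rook_alg n)" "u \<in> tpow n"
  shows "\<rho> a (raise u) = raise (rook_op n a u) \<and> \<rho> a (Fk (raise u)) = Fk (raise (rook_op n a u))"
proof -
  let ?A = "carrier (rook_alg n)"
  have keys: "a \<in> ?A \<longleftrightarrow> Poly_Mapping.keys a \<subseteq> planar_rook n" for a by (simp add: rook_alg_def)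
  have \<rho>: "\<rho> a \<in> carrier (EndC (Suc n))" if "a \<in> ?A" for a
    using assms(1) that by (auto simp: rook_action_def)
  have \<rho>_add: "\<rho> (a + b) f = \<rho> a f + \<rho> b f" if "a \<in> ?A" "b \<in> ?A" "f \<in> tpow (Suc n)" for a b f
    using assms(1) that by (simp add: rook_action_def)
  have \<rho>_scale: "\<rho> (scale c a) f = scale c (\<rho> a f)" if "a \<in> ?A" "f \<in> tpow (Suc n)" for a c f
    using assms(1) that by (simp add: rook_action_def)
  have t: "raise u \<in> tpow (Suc n)" "Fk (raise u) \<in> tpow (Suc n)" if "u \<in> tpow n" for u
    using that by (simp_all add: raise_tpow gact_tpow)
  show ?thesis
    using assms(2) unfolding keys
  proof (induction rule: keys_subset_induct)
    case zero
    have "\<rho> (scale 0 0) f = scale 0 (\<rho> 0 f)" if "f \<in> tpow (Suc n)" for f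
      by (rule \<rho>_scale[OF rook_alg_zero that])
    then show ?case using t[OF assms(3)] by (simp add: linop_zero[OF linop_rook_op_left] lin)
  next
    case (add a b)
    then show ?case
      using t[OF assms(3)] by (simp add: \<rho>_add keys linop_add[OF linop_rook_op_left] lin)
  next
    case (scale c a)
    then show ?case
      using t[OF assms(3)] by (simp add: \<rho>_scale keys linop_scale[OF linop_rook_op_left] lin)
  next
    case (single d)
    note \<rho>d = \<rho>[OF rook_alg_single[OF single]]
    show ?case
      using assms(3)
    proof (induction rule: tpow_induct)
      case zero
      then show ?case by (simp add: lin EndC_zero[OF \<rho>d] linop_zero[OF linop_rook_op])
    next
      case (add u v)
      then show ?case by (simp add: lin EndC_add[OF \<rho>d] linop_add[OF linop_rook_op] t)
    next
      case (scale c u)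
      then show ?case by (simp add: lin EndC_scale[OF \<rho>d] linop_scale[OF linop_rook_op] t)
    next
      case (mon w)
      note s = x_positions_subset[OF mon]
      have "\<rho> (Poly_Mapping.single d 1) (vvec q (Suc n) s) = vvec_diag q (Suc n) d s \<and>
          \<rho> (Poly_Mapping.single d 1) (Fk (vvec q (Suc n) s)) = Fk (vvec_diag q (Suc n) d s)"
        if "s \<subseteq> {1..n}" for s
        using assms(1) single that by (simp add: rook_action_def)
      from this[OF s] show ?case
        by (simp add: mon_eq_uvec[OF mon] vvec_eq_raise vvec_diag_eq_raise[OF s])
    qed
  qed
qed

lemma rook_action_EndC:
  "rook_action q (Suc n) \<rho> \<Longrightarrow> a \<in> carrier (rook_alg n) \<Longrightarrow> \<rho> a \<in> carrier (EndC (Suc n))"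
  by (auto simp: rook_action_def)

lemma rook_action_eq_inflate:
  assumes "rook_action q (Suc n) \<rho>" "a \<in> carrier (rook_alg n)"
  shows "\<rho> a = inflate (rook_op n a)"
  by (rule EndC_eq_on_raise)
     (simp_all add: rook_action_EndC[OF assms] inflate_EndC linop_rook_op rook_op_tpow
       rook_action_raise[OF assms] inflate_raise)

lemma rook_action_inflate:
  "rook_action q (Suc n) (\<lambda>a\<in>carrier (rook_alg n). inflate (rook_op n a))"
  unfolding rook_action_def
proof (intro conjI ballI allI impI)
  show "(\<lambda>a\<in>carrier (rook_alg n). inflate (rook_op n a)) \<in>
      carrier (rook_alg (Suc n - 1)) \<rightarrow>\<^sub>E carrier (EndC (Suc n))"
    by (auto intro: inflate_EndC linop_rook_op rook_op_tpow)
qed (simp_all add: rook_alg_add rook_alg_scale rook_alg_single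
   inflate_def linop_add[OF linop_rook_op_left] linop_scale[OF linop_rook_op_left] lin scale_add
   vvec_eq_raise vvec_diag_eq_raise raise_tpow gact_tpow uvec_tpow parts_raise parts_Fk_raise
   linop_zero[OF linop_diag_op])

lemma rook_action_unique: "\<exists>!\<rho>. rook_action q (Suc n) \<rho>"
proof (rule ex1I[where P = "rook_action q (Suc n)", OF rook_action_inflate])
  fix \<rho> assume \<rho>: "rook_action q (Suc n) \<rho>"
  then have "\<rho> \<in> extensional (carrier (rook_alg n))" by (auto simp: rook_action_def PiE_def)
  then show "\<rho> = (\<lambda>a\<in>carrier (rook_alg n). inflate (rook_op n a))"
    by (intro extensionalityI[OF _ restrict_extensional]) (simp_all add: rook_action_eq_inflate[OF \<rho>])
qed

lemma rook_action_ring_hom: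
  assumes "rook_action q (Suc n) \<rho>"
  shows "\<rho> \<in> ring_hom (rook_alg n) (EndC (Suc n))"
proof (rule ring_hom_memI)
  note R = rook_action_EndC[OF assms] and act = rook_action_raise[OF assms]
  note mem = raise_tpow gact_tpow rook_op_tpow
  fix a b assume a: "a \<in> carrier (rook_alg n)" and b: "b \<in> carrier (rook_alg n)"
  show "\<rho> a \<in> carrier (EndC (Suc n))" by (rule R[OF a])
  have comp: "\<rho> a \<otimes>\<^bsub>EndC (Suc n)\<^esub> \<rho> b = (\<lambda>f\<in>tpow (Suc n). \<rho> a (\<rho> b f))"
    by (simp add: EndC_def compose_def)
  have "\<rho> a \<otimes>\<^bsub>EndC (Suc n)\<^esub> \<rho> b \<in> carrier (EndC (Suc n))"
    unfolding comp using R[OF a] R[OF b] by (auto simp: EndC_def tpow_add tpow_scale Pi_iff PiE_iff)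
  then show "\<rho> (a \<otimes>\<^bsub>rook_alg n\<^esub> b) = \<rho> a \<otimes>\<^bsub>EndC (Suc n)\<^esub> \<rho> b"
    by (rule EndC_eq_on_raise[OF R[OF rook_alg_closed[OF a b]]])
       (simp_all add: act a b rook_alg_closed comp mem rook_op_mult)
  have "\<rho> (a + b) f = \<rho> a f + \<rho> b f" if "f \<in> tpow (Suc n)" for f
    using assms a b that by (simp add: rook_action_def)
  then have "\<rho> (a + b) = (\<lambda>f\<in>tpow (Suc n). \<rho> a f + \<rho> b f)"
    using R[OF rook_alg_add[OF a b]]
    by (intro extensionalityI[of _ "tpow (Suc n)"]) (auto simp: EndC_def PiE_def)
  then show "\<rho> (a \<oplus>\<^bsub>rook_alg n\<^esub> b) = \<rho> a \<oplus>\<^bsub>EndC (Suc n)\<^esub> \<rho> b"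
    by (simp add: rook_alg_def EndC_def)
next
  have one: "\<one>\<^bsub>EndC (Suc n)\<^esub> = (\<lambda>f\<in>tpow (Suc n). f)" by (simp add: EndC_def)
  show "\<rho> \<one>\<^bsub>rook_alg n\<^esub> = \<one>\<^bsub>EndC (Suc n)\<^esub>"
    unfolding one
    by (rule EndC_eq_on_raise)
       (simp_all add: rook_action_EndC[OF assms] rook_alg_one EndC_restrict[OF linop_id]
         rook_action_raise[OF assms] rook_op_one raise_tpow gact_tpow)
qed

lemma rook_action_inj:
  assumes "rook_action q (Suc n) \<rho>"
  shows "inj_on \<rho> (carrier (rook_alg n))"
proof (rule inj_onI)
  fix a b assume ab: "a \<in> carrier (rook_alg n)" "b \<in> carrier (rook_alg n)" "\<rho> a = \<rho> b"
  have "rook_op n (a - b) u = 0" if u: "u \<in> tpow n" for u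
  proof -
    have "raise (rook_op n a u) = raise (rook_op n b u)"
      using rook_action_raise[OF assms ab(1) u] rook_action_raise[OF assms ab(2) u] ab(3) by simp
    then have "rook_op n a u = rook_op n b u"
      using x_part_raise rook_op_tpow u by metis
    then show ?thesis by (simp add: linop_diff[OF linop_rook_op_left])
  qed
  then have "a - b = 0" using rook_op_faithful rook_alg_diff ab by blast
  then show "a = b" by simp
qed

section \<open>Commutation with the quantum group\<close>

text \<open>
  Moving \<open>q\<^sup>h\<close> past \<open>E\<close> costs the weight \<open>\<alpha>\<close>, and acting on \<open>y\<close> the weight \<open>\<epsilon>\<^sub>2\<close>; together this is \<open>\<epsilon>\<^sub>1\<close>.  For
  \<open>\<sigma>\<close> the two signs cancel.
\<close>

lemma cartan_raise:
  assumes "g \<noteq> gE" "g \<noteq> gF" "u \<in> tpow n"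
  shows "gact q (Suc n) g (raise u) = scale (cartan_weight q g Bx) (raise (gact q n g u))"
proof (cases g)
  case (gQ h)
  have "pairing h alpha + pairing h eps2 = pairing h eps1"
    by (simp add: pairing_def alpha_def eps1_def eps2_def)
  then have "q powi pairing h alpha * q powi pairing h eps2 = q powi pairing h eps1"
    using q_nonzero by (simp flip: power_int_add)
  moreover have "gact q (Suc n) (gQ h) (mon [By] * u)
      = scale (q powi pairing h eps2) (mon [By] * gact q n (gQ h) u)"
    using assms(3) by (simp add: gact_split tpow_mon gact_one_mon scale_mult_left)
  ultimately show ?thesis
    using module_rels(3)[OF letter_mult_tpow[OF assms(3), of By], of h] by (simp add: gQ raise_def lin)
next
  case gSigma
  have "gact q (Suc n) gSigma (mon [By] * u) = - (mon [By] * gact q n gSigma u)"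
    using assms(3) by (simp add: gact_split tpow_mon gact_one_mon)
  then show ?thesis
    using module_rels(8)[OF letter_mult_tpow[OF assms(3), of By]] by (simp add: gSigma raise_def lin)
qed (use assms in auto)

lemma cartan_Fk:
  assumes "g \<noteq> gE" "g \<noteq> gF"
  obtains c where "\<And>f. f \<in> tpow (Suc n) \<Longrightarrow> gact q (Suc n) g (Fk f) = scale c (Fk (gact q (Suc n) g f))"
proof (cases g)
  case (gQ h)
  then show ?thesis using that module_rels(4) by blast
next
  case gSigma
  then show ?thesis using that[of "- 1"] module_rels(9) by (simp add: uminus_scale[symmetric])
qed (use assms in auto)

text \<open>
  A diagram preserves the size of the subsets on which it is defined, hence the eigenvalues.
\<close>

lemma cartan_diag_op:
  assumes "g \<noteq> gE" "g \<noteq> gF" "d \<in> planar_rook n" "u \<in> tpow n"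
  shows "gact q n g (diag_op n d u) = diag_op n d (gact q n g u)"
proof (rule linop_eq_tpow[OF linop_comp[OF linop_gact linop_diag_op] linop_comp[OF linop_diag_op linop_gact] assms(4)])
  fix w :: "basis list" assume w: "length w = n"
  define s where "s = x_positions w"
  have s: "s \<subseteq> {1..n}" using w unfolding s_def by (rule x_positions_subset)
  show "gact q n g (diag_op n d (mon w)) = diag_op n d (gact q n g (mon w))"
    unfolding mon_eq_uvec[OF w] s_def[symmetric] gact_cartan_uvec[OF assms(1,2) s]
      linop_scale[OF linop_diag_op] diag_op_uvec[OF s]
    using gact_cartan_uvec[OF assms(1,2) planar_rook_image[OF assms(3)], of s q]
      planar_rook_card_image[OF assms(3), of s]
    by (simp add: lin)
qed

lemma cartan_rook_op:
  assumes "g \<noteq> gE" "g \<noteq> gF" "a \<in> carrier (rook_alg n)" "u \<in> tpow n"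
  shows "gact q n g (rook_op n a u) = rook_op n a (gact q n g u)"
  unfolding rook_op_def lin_ext_def linop_sum[OF linop_gact] linop_scale[OF linop_gact]
  using assms by (intro sum.cong refl) (auto simp: cartan_diag_op rook_alg_def subset_iff)

lemma commutes_if_on_raise:
  assumes \<phi>: "\<phi> \<in> carrier (EndC (Suc n))"
    and raise: "\<And>u. u \<in> tpow n \<Longrightarrow> \<phi> (gact q (Suc n) g (raise u)) = gact q (Suc n) g (\<phi> (raise u))"
    and low: "\<And>u. u \<in> tpow n \<Longrightarrow> \<phi> (gact q (Suc n) g (Fk (raise u))) = gact q (Suc n) g (\<phi> (Fk (raise u)))"
    and f: "f \<in> tpow (Suc n)"
  shows "\<phi> (gact q (Suc n) g f) = gact q (Suc n) g (\<phi> f)"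
proof -
  have "(\<lambda>f\<in>tpow (Suc n). \<phi> (gact q (Suc n) g f)) = (\<lambda>f\<in>tpow (Suc n). gact q (Suc n) g (\<phi> f))"
    by (rule EndC_eq_on_raise)
       (simp_all add: EndC_comp \<phi> linop_gact gact_tpow raise_tpow raise low)
  from fun_cong[OF this, of f] show ?thesis using f by simp
qed

lemma rook_action_End_Uq:
  assumes "rook_action q (Suc n) \<rho>" "a \<in> carrier (rook_alg n)"
  shows "\<rho> a \<in> End_Uq q (Suc n)"
proof -
  note \<phi> = rook_action_EndC[OF assms] and act = rook_action_raise[OF assms]
  have "\<rho> a (gact q (Suc n) g f) = gact q (Suc n) g (\<rho> a f)" if f: "f \<in> tpow (Suc n)" for g f
  proof (rule commutes_if_on_raise[OF \<phi> _ _ f])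
    fix u assume u: "u \<in> tpow n"
    note mem = u rook_op_tpow gact_tpow raise_tpow
    show "\<rho> a (gact q (Suc n) g (raise u)) = gact q (Suc n) g (\<rho> a (raise u))"
    proof (cases "g = gE \<or> g = gF")
      case True
      then show ?thesis by (auto simp: act Ek_raise mem EndC_zero[OF \<phi>])
    next
      case False
      then show ?thesis
        by (simp add: act cartan_raise mem EndC_scale[OF \<phi>] cartan_rook_op assms(2))
    qed
    show "\<rho> a (gact q (Suc n) g (Fk (raise u))) = gact q (Suc n) g (\<rho> a (Fk (raise u)))"
    proof (cases "g = gE \<or> g = gF")
      case True
      then show ?thesis
        by (auto simp: act Ek_Fk_raise Fk_Fk mem EndC_zero[OF \<phi>] EndC_scale[OF \<phi>])
    next
      case False
      then obtain c where c: "\<And>f. f \<in> tpow (Suc n) \<Longrightarrow>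
          gact q (Suc n) g (Fk f) = scale c (Fk (gact q (Suc n) g f))"
        using cartan_Fk by metis
      from False show ?thesis
        by (simp add: act c cartan_raise mem EndC_scale[OF \<phi>] cartan_rook_op assms(2) lin)
    qed
  qed
  with \<phi> show ?thesis by (simp add: End_Uq_iff[OF q_nonzero q_neq_inverse])
qed

text \<open>
  This lets the eigenvalues \<open>q\<^sup>|\<^sup>s\<^sup>|\<close> of \<open>q\<^sup>h\<^sup>1\<close> separate the subsets by size.
\<close>

lemma q_power_inject: "q ^ i = q ^ j \<Longrightarrow> i = j"
proof (induction i j rule: linorder_wlog)
  case (le i j)
  then have "q ^ i * q ^ (j - i) = q ^ i * 1" using power_add[of q i "j - i"] by simp
  then have "q ^ (j - i) = 1" using q_nonzero by simp
  then show ?case using le q_generic[of "j - i"] by (cases "j - i") auto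
qed auto

text \<open>
  Because \<open>\<phi>\<close> commutes with \<open>E\<close>, it maps \<open>E (y \<otimes> u)\<close> into the image of \<open>E\<close>, which is the image of \<open>raise\<close>.
\<close>

lemma End_Uq_raise:
  assumes "\<phi> \<in> End_Uq q (Suc n)" "u \<in> tpow n"
  shows "raise (x_part (\<phi> (raise u))) = \<phi> (raise u)"
proof -
  from assms(1) have \<phi>: "\<phi> \<in> carrier (EndC (Suc n))"
    and "\<And>f. f \<in> tpow (Suc n) \<Longrightarrow> \<phi> (Ek f) = Ek (\<phi> f)"
    by (simp_all add: End_Uq_iff[OF q_nonzero q_neq_inverse])
  then have "\<phi> (raise u) = Ek (\<phi> (mon [By] * u))"
    by (simp add: raise_def letter_mult_tpow assms(2))
  then show ?thesis by (simp add: raise_x_part EndC_tpow[OF \<phi>] letter_mult_tpow assms(2))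
qed

text \<open>
  The operator \<open>\<Phi>\<close> induced by \<open>\<phi>\<close> on \<open>V\<^sup>\<otimes>\<^sup>n\<close> commutes with \<open>q\<^sup>h\<^sup>1\<close>, so it cannot connect subsets of different
  sizes and comes from the rook algebra.  As \<open>\<phi>\<close> commutes with \<open>F\<close>, agreement on the first copy
  of \<open>V\<^sup>\<otimes>\<^sup>n\<close> suffices.
\<close>

lemma End_Uq_image:
  assumes "rook_action q (Suc n) \<rho>" "\<phi> \<in> End_Uq q (Suc n)"
  shows "\<phi> \<in> \<rho> ` carrier (rook_alg n)"
proof -
  from assms(2) have \<phi>: "\<phi> \<in> carrier (EndC (Suc n))"
    and comm: "\<And>g f. f \<in> tpow (Suc n) \<Longrightarrow> \<phi> (gact q (Suc n) g f) = gact q (Suc n) g (\<phi> f)"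
    by (simp_all add: End_Uq_iff[OF q_nonzero q_neq_inverse])
  \<comment> \<open>Off \<open>tpow n\<close> the map \<open>\<phi>\<close> carries no information, so extend by zero to get a linear operator.\<close>
  define \<Phi> where "\<Phi> = lin_ext (\<lambda>w. if length (letters w) = n then x_part (\<phi> (raise (mon (letters w)))) else 0)"
  have lin\<Phi>: "linop \<Phi>" unfolding \<Phi>_def by (rule linop_lin_ext)
  have \<Phi>: "\<Phi> u = x_part (\<phi> (raise u))" if "u \<in> tpow n" for u
    using that
  proof (induction rule: tpow_induct)
    case zero
    show ?case by (simp add: linop_zero[OF lin\<Phi>] lin EndC_zero[OF \<phi>])
  next
    case (add u v)
    then show ?case by (simp add: linop_add[OF lin\<Phi>] lin EndC_add[OF \<phi>] raise_tpow)
  next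
    case (scale c u)
    then show ?case by (simp add: linop_scale[OF lin\<Phi>] lin EndC_scale[OF \<phi>] raise_tpow)
  next
    case (mon w)
    then show ?case by (simp add: \<Phi>_def)
  qed
  have \<Phi>_tpow: "\<Phi> u \<in> tpow n" if "u \<in> tpow n" for u
    using that by (simp add: \<Phi> x_part_tpow EndC_tpow[OF \<phi>] raise_tpow)
  have raise\<Phi>: "raise (\<Phi> u) = \<phi> (raise u)" if "u \<in> tpow n" for u
    using that by (simp add: \<Phi> End_Uq_raise[OF assms(2)])
  have weight: "Poly_Mapping.lookup (\<Phi> (uvec (Suc n) s)) (Word (subset_word n t)) = 0"
    if s: "s \<subseteq> {1..n}" and t: "t \<subseteq> {1..n}" and neq: "card s \<noteq> card t" for s t
  proof -
    let ?g = "gQ h1" and ?u = "uvec (Suc n) s"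
    have g: "?g \<noteq> gE" "?g \<noteq> gF" by simp_all
    have wt: "cartan_weight q ?g Bx = q" "subset_weight q n ?g m = q ^ m" for m
      by (simp_all add: subset_weight_def pairing_def h1_def eps1_def eps2_def)
    have "scale q (raise (gact q n ?g (\<Phi> ?u))) = gact q (Suc n) ?g (raise (\<Phi> ?u))"
      by (simp only: cartan_raise[OF g \<Phi>_tpow[OF uvec_tpow]] wt)
    also have "\<dots> = \<phi> (gact q (Suc n) ?g (raise ?u))"
      by (simp add: raise\<Phi> uvec_tpow comm raise_tpow)
    also have "\<dots> = scale q (raise (scale (q ^ card s) (\<Phi> ?u)))"
      by (simp only: cartan_raise[OF g uvec_tpow] gact_cartan_uvec[OF g s] wt)
         (simp add: lin EndC_scale[OF \<phi>] raise_tpow uvec_tpow raise\<Phi>)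
    finally have "raise (gact q n ?g (\<Phi> ?u)) = raise (scale (q ^ card s) (\<Phi> ?u))"
      using q_nonzero by (metis scale_scale scale_one left_inverse)
    then have eigen: "gact q n ?g (\<Phi> ?u) = scale (q ^ card s) (\<Phi> ?u)"
      using x_part_raise by (metis gact_tpow tpow_scale \<Phi>_tpow uvec_tpow)
    \<comment> \<open>Compare the coefficients of \<open>u\<^sub>t\<close> on both sides.\<close>
    let ?c = "\<lambda>t. Poly_Mapping.lookup (\<Phi> ?u) (Word (subset_word n t))"
    have "gact q n ?g (\<Phi> ?u) = gact q n ?g (\<Sum>r\<in>Pow {1..n}. scale (?c r) (uvec (Suc n) r))"
      using tpow_uvec_expand[OF \<Phi>_tpow[OF uvec_tpow]] by (rule arg_cong)
    also have "\<dots> = (\<Sum>r\<in>Pow {1..n}. scale (?c r * q ^ card r) (uvec (Suc n) r))"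
      unfolding linop_sum[OF linop_gact] linop_scale[OF linop_gact]
      by (intro sum.cong refl) (simp only: Pow_iff gact_cartan_uvec[OF g] wt scale_scale)
    finally have "Poly_Mapping.lookup (gact q n ?g (\<Phi> ?u)) (Word (subset_word n t))
        = (\<Sum>r\<in>Pow {1..n}. ?c r * q ^ card r * Poly_Mapping.lookup (uvec (Suc n) r) (Word (subset_word n t)))"
      by (simp only: lookup_sum lookup_scale)
    also have "\<dots> = (\<Sum>r\<in>Pow {1..n}. if r = t then ?c t * q ^ card t else 0)"
      by (intro sum.cong refl) (simp only: Pow_iff lookup_uvec[OF _ t], simp)
    also have "\<dots> = ?c t * q ^ card t" using t by simp
    finally have "?c t * q ^ card t = ?c t * q ^ card s"
      by (metis eigen lookup_scale mult.commute)
    then show ?thesis using neq by (metis mult_cancel_left q_power_inject)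
  qed
  obtain a where a: "a \<in> carrier (rook_alg n)" "\<And>u. u \<in> tpow n \<Longrightarrow> rook_op n a u = \<Phi> u"
    using rook_op_surj[OF lin\<Phi> \<Phi>_tpow weight] by metis
  have "\<rho> a = \<phi>"
    by (rule EndC_eq_on_raise[OF rook_action_EndC[OF assms(1) a(1)] \<phi>])
       (simp_all add: rook_action_raise[OF assms(1) a(1)] a(2) raise\<Phi> comm raise_tpow)
  with a(1) show ?thesis by blast
qed

end

theorem theorem6p5:
  fixes k :: nat and q :: complex
  assumes "k \<ge> 1" and "q \<noteq> 0" and "\<forall>m::nat. m \<ge> 1 \<longrightarrow> q ^ m \<noteq> 1"
  shows "(\<exists>!\<rho>. rook_action q k \<rho>) \<and>
    (\<forall>\<rho>. rook_action q k \<rho> \<longrightarrow>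
       \<rho> \<in> ring_hom (rook_alg (k - 1)) (EndC k) \<and>
       inj_on \<rho> (carrier (rook_alg (k - 1))) \<and>
       \<rho> ` carrier (rook_alg (k - 1)) = End_Uq q k)"
proof -
  obtain n where k: "k = Suc n" using assms(1) by (cases k) auto
  interpret generic_gl11 q n by standard (use assms in auto)
  show ?thesis
    unfolding k diff_Suc_1
    using rook_action_unique rook_action_ring_hom rook_action_inj rook_action_End_Uq End_Uq_image
    by (auto simp: set_eq_iff)
qed

end
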